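(* There exists a locally finite uniform tree with fins $\mathbf{X}$ with the following properties: (1) There is no uniform lattice $\Gamma\leq\operatorname{Aut}(\mathbf{X})$ such that the natural map $\Gamma\backslash\mathbf{X}\to\operatorname{Aut}(\mathbf{X})\backslash\mathbf{X}$ is an isomorphism. (2) Let $X\subset\mathbf{X}$ be the underlying tree, let $VX$ be its set of vertices, and for $x\in VX$ let $E_X(x)$ denote the collection of edges of $X$ that are incident to $x$. There is no uniform lattice $\Gamma\leq\operatorname{Aut}(\mathbf{X})$ such that, for every $x\in VX$, every permutation of $E_X(x)$ induced by an automorphism in the stabiliser $\operatorname{Aut}(\mathbf{X})_x$ is also induced by an automorphism in $\Gamma_x$.
   Context: Tree with fins: let $X$ be a tree (a 1-dimensional cell complex) and let $\Delta$ be a collection of (combinatorial, i.e. vertex-to-vertex and edge-to-edge) embeddings of trees $\gamma:Y\to X$ (the tree $Y$ may vary with $\gamma$). The associated tree with fins $\mathbf{X}$ is the CAT(0) square complex given by the mapping cylinder of $\bigcup_\Delta\gamma:\bigsqcup_\Delta Y\to X$, i.e. as a space $$\mathbf{X}=\Big(X\sqcup\bigsqcup_{\Delta}Y\times[0,1]\Big)/\sim,\qquad (y,0)\sim\gamma(y)\ \text{ for } y\in Y,\ (\gamma:Y\to X)\in\Delta,$$ where the squares come from the subspaces $e\times[0,1]$ for edges $e$ of $Y$. The tree $X$ is regarded as a subcomplex of $\mathbf{X}$ (the underlying tree), and each subcomplex $Y\times\{1\}$ is called a fin. $\mathbf{X}$ is locally finite if it is a locally finite square complex. For $\mathbf{X}$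 a locally finite tree with fins, $\operatorname{Aut}(\mathbf{X})$ is the group of all cubical automorphisms of $\mathbf{X}$ that preserve the underlying tree $X\subset\mathbf{X}$, with the compact-open topology. A subgroup $\Gamma\leq\operatorname{Aut}(\mathbf{X})$ is a uniform lattice if $\Gamma$ acts properly and cocompactly on $\mathbf{X}$ (equivalently, the action on the vertices of $\mathbf{X}$ has finite stabilisers and finitely many orbits). $\mathbf{X}$ is uniform if $\operatorname{Aut}(\mathbf{X})$ contains a uniform lattice. The natural map $\Gamma\backslash\mathbf{X}\to\operatorname{Aut}(\mathbf{X})\backslash\mathbf{X}$ is the (always surjective) map sending the $\Gamma$-orbit of a point to its $\operatorname{Aut}(\mathbf{X})$-orbit; it is an isomorphism exactly when $\Gamma$ and $\operatorname{Aut}(\mathbf{X})$ have the same orbits on $\mathbf{X}$. *)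

theory Defs
  imports "HOL-Analysis.Function_Topology" "HOL-Algebra.Group_Action" "HOL-Algebra.Bij"
begin

record 'v graph =
  verts :: "'v set"
  edges :: "'v set set"

definition vertex_path :: "'v graph \<Rightarrow> 'v \<Rightarrow> 'v \<Rightarrow> 'v list \<Rightarrow> bool" where
  "vertex_path G u v p \<longleftrightarrow> p \<noteq> [] \<and> hd p = u \<and> last p = v \<and> set p \<subseteq> verts G \<and> distinct p \<and>
     successively (\<lambda>a b. {a, b} \<in> edges G) p"

definition tree :: "'v graph \<Rightarrow> bool" where
  "tree G \<longleftrightarrow> verts G \<noteq> {} \<and> (\<forall>e\<in>edges G. e \<subseteq> verts G \<and> card e = 2) \<and>
     (\<forall>u\<in>verts G. \<forall>v\<in>verts G. \<exists>!p. vertex_path G u v p)"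

(* Combinatorial embedding.  An edge is determined by its end points, so injectivity on
   vertices is injectivity of the induced map of 1-dimensional cell complexes. *)
definition tree_embedding :: "'y graph \<Rightarrow> 'v graph \<Rightarrow> ('y \<Rightarrow> 'v) \<Rightarrow> bool" where
  "tree_embedding Y X \<gamma> \<longleftrightarrow> \<gamma> ` verts Y \<subseteq> verts X \<and> (\<forall>e\<in>edges Y. \<gamma> ` e \<in> edges X) \<and>
     inj_on \<gamma> (verts Y)"

(* The collection of embeddings is an indexed family, so that several fins may be attached
   along the same subtree.  The domain of the embedding with index i is "fin_tree T i". *)
record ('v, 'i, 'y) fin_data =
  base_tree :: "'v graph"
  fin_index :: "'i set"
  fin_tree :: "'i \<Rightarrow> 'y graph"
  fin_map :: "'i \<Rightarrow> 'y \<Rightarrow> 'v"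

definition tree_with_fins :: "('v, 'i, 'y) fin_data \<Rightarrow> bool" where
  "tree_with_fins T \<longleftrightarrow> tree (base_tree T) \<and>
     (\<forall>i\<in>fin_index T. tree (fin_tree T i) \<and> tree_embedding (fin_tree T i) (base_tree T) (fin_map T i))"

(* "Base v" is the vertex v of the underlying tree, and "Fin i y" is the vertex (y, 1) of the
   fin with index i.  The vertex (y, 0) is identified with "Base (fin_map T i y)".
   Every cell of the complex is determined by its set of vertices, and is encoded by it. *)
datatype ('v, 'i, 'y) cvertex = Base 'v | Fin 'i 'y

definition base_vertices :: "('v, 'i, 'y) fin_data \<Rightarrow> ('v, 'i, 'y) cvertex set" where
  "base_vertices T = Base ` verts (base_tree T)"

definition base_edges :: "('v, 'i, 'y) fin_data \<Rightarrow> ('v, 'i, 'y) cvertex set set" where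
  "base_edges T = {Base ` e | e. e \<in> edges (base_tree T)}"

definition vertices :: "('v, 'i, 'y) fin_data \<Rightarrow> ('v, 'i, 'y) cvertex set" where
  "vertices T = base_vertices T \<union> {Fin i y | i y. i \<in> fin_index T \<and> y \<in> verts (fin_tree T i)}"

definition cedges :: "('v, 'i, 'y) fin_data \<Rightarrow> ('v, 'i, 'y) cvertex set set" where
  "cedges T = base_edges T
     \<union> {Fin i ` e | i e. i \<in> fin_index T \<and> e \<in> edges (fin_tree T i)}
     \<union> {{Base (fin_map T i y), Fin i y} | i y. i \<in> fin_index T \<and> y \<in> verts (fin_tree T i)}"

definition squares :: "('v, 'i, 'y) fin_data \<Rightarrow> ('v, 'i, 'y) cvertex set set" where
  "squares T =
     {Base ` fin_map T i ` e \<union> Fin i ` e | i e. i \<in> fin_index T \<and> e \<in> edges (fin_tree T i)}"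

definition locally_finite :: "('v, 'i, 'y) fin_data \<Rightarrow> bool" where
  "locally_finite T \<longleftrightarrow>
     (\<forall>v\<in>vertices T. finite {e \<in> cedges T. v \<in> e} \<and> finite {s \<in> squares T. v \<in> s})"

(* A point of a graph is given by its barycentric coordinates. *)
definition graph_points :: "'v graph \<Rightarrow> ('v \<Rightarrow> real) set" where
  "graph_points G = {w. (\<forall>v. 0 \<le> w v) \<and>
     {v. w v \<noteq> 0} \<in> {{v} | v. v \<in> verts G} \<union> edges G \<and> (\<Sum>v | w v \<noteq> 0. w v) = 1}"

(* Affine extension of a vertex map, for w of finite support. *)
definition push :: "('a \<Rightarrow> 'b) \<Rightarrow> ('a \<Rightarrow> real) \<Rightarrow> 'b \<Rightarrow> real" where
  "push f w = (\<lambda>z. \<Sum>v | w v \<noteq> 0 \<and> f v = z. w v)"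

(* The class of (w, t) in the mapping cylinder.  For t = 0 this is the image of w in the
   underlying tree.  On a square, the coordinates are the bilinear weights
   (1-s)(1-t), s(1-t), (1-s)t, st of the four corners. *)
definition cylinder_point ::
  "('v, 'i, 'y) fin_data \<Rightarrow> 'i \<Rightarrow> ('y \<Rightarrow> real) \<Rightarrow> real \<Rightarrow> ('v, 'i, 'y) cvertex \<Rightarrow> real" where
  "cylinder_point T i w t =
     (\<lambda>z. (1 - t) * push (\<lambda>y. Base (fin_map T i y)) w z + t * push (Fin i) w z)"

(* As a subspace of the product space "cvertex => real".  For a locally finite complex this is
   the topology of the cell complex: the open star of v is the open set where the coordinate
   at v is positive, and it lies in a finite subcomplex. *)
definition realization :: "('v, 'i, 'y) fin_data \<Rightarrow> (('v, 'i, 'y) cvertex \<Rightarrow> real) set" where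
  "realization T = push Base ` graph_points (base_tree T)
     \<union> {cylinder_point T i w t | i w t.
          i \<in> fin_index T \<and> w \<in> graph_points (fin_tree T i) \<and> 0 \<le> t \<and> t \<le> 1}"

(* Since cells are determined by their vertices, a cubical automorphism is a permutation of the
   vertices that maps edges onto edges and squares onto squares.  Elements of "Bij" are
   extensional, so distinct elements are distinct automorphisms. *)
definition automorphisms ::
  "('v, 'i, 'y) fin_data \<Rightarrow> (('v, 'i, 'y) cvertex \<Rightarrow> ('v, 'i, 'y) cvertex) set" where
  "automorphisms T = {g \<in> Bij (vertices T).
     image g ` cedges T = cedges T \<and> image g ` squares T = squares T \<and>
     g ` base_vertices T = base_vertices T \<and> image g ` base_edges T = base_edges T}"

definition Aut ::
  "('v, 'i, 'y) fin_data \<Rightarrow> (('v, 'i, 'y) cvertex \<Rightarrow> ('v, 'i, 'y) cvertex) monoid" where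
  "Aut T = (BijGroup (vertices T))\<lparr>carrier := automorphisms T\<rparr>"

(* The subgroup of Aut with underlying set H, as a group in its own right. *)
abbreviation Aut_sub ::
  "('v, 'i, 'y) fin_data \<Rightarrow> (('v, 'i, 'y) cvertex \<Rightarrow> ('v, 'i, 'y) cvertex) set
    \<Rightarrow> (('v, 'i, 'y) cvertex \<Rightarrow> ('v, 'i, 'y) cvertex) monoid" where
  "Aut_sub T H \<equiv> (Aut T)\<lparr>carrier := H\<rparr>"

(* "push g" is the action of the automorphism g on the points of the complex. *)

definition acts_properly ::
  "('v, 'i, 'y) fin_data \<Rightarrow> (('v, 'i, 'y) cvertex \<Rightarrow> ('v, 'i, 'y) cvertex) set \<Rightarrow> bool" where
  "acts_properly T H \<longleftrightarrow>
     (\<forall>K. K \<subseteq> realization T \<and> compact K \<longrightarrow> finite {g \<in> H. push g ` K \<inter> K \<noteq> {}})"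

definition acts_cocompactly ::
  "('v, 'i, 'y) fin_data \<Rightarrow> (('v, 'i, 'y) cvertex \<Rightarrow> ('v, 'i, 'y) cvertex) set \<Rightarrow> bool" where
  "acts_cocompactly T H \<longleftrightarrow>
     (\<exists>K. K \<subseteq> realization T \<and> compact K \<and> (\<Union>g\<in>H. push g ` K) = realization T)"

definition uniform_lattice ::
  "('v, 'i, 'y) fin_data \<Rightarrow> (('v, 'i, 'y) cvertex \<Rightarrow> ('v, 'i, 'y) cvertex) set \<Rightarrow> bool" where
  "uniform_lattice T H \<longleftrightarrow> subgroup H (Aut T) \<and> acts_properly T H \<and> acts_cocompactly T H"

definition uniform :: "('v, 'i, 'y) fin_data \<Rightarrow> bool" where
  "uniform T \<longleftrightarrow> (\<exists>H. uniform_lattice T H)"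

definition quotient ::
  "('v, 'i, 'y) fin_data \<Rightarrow> (('v, 'i, 'y) cvertex \<Rightarrow> ('v, 'i, 'y) cvertex) set
    \<Rightarrow> (('v, 'i, 'y) cvertex \<Rightarrow> real) set set" where
  "quotient T H = orbits (Aut_sub T H) (realization T) push"

(* The Aut-orbits of all points of the given orbit coincide. *)
definition natural_map ::
  "('v, 'i, 'y) fin_data \<Rightarrow> (('v, 'i, 'y) cvertex \<Rightarrow> real) set
    \<Rightarrow> (('v, 'i, 'y) cvertex \<Rightarrow> real) set" where
  "natural_map T P = (\<Union>p\<in>P. orbit (Aut T) push p)"

(* The natural map is surjective and induced by the identity of the complex, so it is an
   isomorphism when it is a bijection on points. *)
definition natural_map_iso ::
  "('v, 'i, 'y) fin_data \<Rightarrow> (('v, 'i, 'y) cvertex \<Rightarrow> ('v, 'i, 'y) cvertex) set \<Rightarrow> bool" where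
  "natural_map_iso T H \<longleftrightarrow>
     bij_betw (natural_map T) (quotient T H) (quotient T (automorphisms T))"

definition incident_edges :: "('v, 'i, 'y) fin_data \<Rightarrow> 'v \<Rightarrow> ('v, 'i, 'y) cvertex set set" where
  "incident_edges T x = {e \<in> base_edges T. Base x \<in> e}"

definition induced_permutations ::
  "('v, 'i, 'y) fin_data \<Rightarrow> (('v, 'i, 'y) cvertex \<Rightarrow> ('v, 'i, 'y) cvertex) set \<Rightarrow> 'v
    \<Rightarrow> (('v, 'i, 'y) cvertex set \<Rightarrow> ('v, 'i, 'y) cvertex set) set" where
  "induced_permutations T H x =
     (\<lambda>g. restrict (image g) (incident_edges T x)) ` stabilizer (Aut_sub T H) (\<lambda>g. g) (Base x)"

end

theory Submission
  imports Defs "HOL-Library.Numeral_Type" "HOL-Library.Sublist"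
begin

text \<open>The underlying tree \<open>X\<close> is the Cayley tree of the free group of rank three.  Its edges are
  oriented by the generators, so that every vertex has three in-neighbours and three out-neighbours,
  and the out-neighbours of a vertex are cyclically ordered by a cyclic order of the generators.  Fins
  are attached along small finite subtrees, the corners, in such a way that the automorphisms of the
  complex preserve the orientation and the cyclic orders (lemma \<open>automorphism_turn\<close>), and that
  conversely all symmetries of this structure act on the complex (lemma \<open>lift_automorphism\<close>).  The left
  translations of the free group are symmetries, and they form a uniform lattice (lemma \<open>uniform_T\<close>).

  The stabiliser of a vertex in the automorphism group induces the symmetric group \<open>S\<^sub>3\<close> on its
  in-neighbours and the cyclic group \<open>C\<^sub>3\<close> on its out-neighbours.  The point of the construction is that
  these groups have no common nontrivial quotient.  Suppose that a subgroup \<open>\<Gamma>\<close> also induces these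
  groups at every vertex.  Let \<open>H\<close> be the stabiliser in \<open>\<Gamma>\<close> of a directed path, and suppose that \<open>H\<close>
  induces \<open>S\<^sub>3\<close> on the in-neighbours of the first vertex and \<open>C\<^sub>3\<close> on the out-neighbours of the last
  one.  By Goursat's lemma \<open>H\<close> maps onto \<open>S\<^sub>3 \<times> C\<^sub>3\<close>, and so the subgroup that fixes an out-neighbour of the
  last vertex still induces \<open>S\<^sub>3\<close> at the first one, and the subgroup that fixes an in-neighbour of the first
  vertex still induces \<open>C\<^sub>3\<close> at the last one.  By induction the stabilisers of all directed paths
  act nontrivially at the ends of these paths (lemma \<open>path_stabilizer_locally_full\<close>).  Hence the vertex
  stabilisers in \<open>\<Gamma>\<close> are infinite, and \<open>\<Gamma>\<close> does not act properly (lemma \<open>locally_full_not_proper\<close>).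

  Each of the two properties in question forces \<open>\<Gamma>\<close> to induce \<open>S\<^sub>3\<close> and \<open>C\<^sub>3\<close>.  For the property about
  permutations of edges this is immediate (lemma \<open>same_permutations_locally_full\<close>).  If \<open>\<Gamma>\<close> has the same
  orbits as the automorphism group, it is because the orbit of a vertex of a fin contains the information
  how the ordered pair of in-neighbours in the corner is moved (lemma \<open>natural_map_iso_locally_full\<close>).\<close>

section \<open>Trees\<close>

lemma vertex_path_Cons:
  "vertex_path G u v (x # p) \<longleftrightarrow>
     x = u \<and> u \<in> verts G \<and> (p = [] \<and> u = v \<or>
       p \<noteq> [] \<and> {u, hd p} \<in> edges G \<and> u \<notin> set p \<and> vertex_path G (hd p) v p)"
  by (cases p) (auto simp: vertex_path_def)

lemma vertex_path_crossing:
  assumes "vertex_path G u v p" "u \<notin> D" "v \<in> D"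
  shows "\<exists>q x y r. p = q @ x # y # r \<and> x \<notin> D \<and> y \<in> D \<and> {x, y} \<in> edges G"
  using assms
proof (induction p arbitrary: u)
  case Nil
  then show ?case by (simp add: vertex_path_def)
next
  case (Cons a p)
  then have p: "a = u" "p \<noteq> []" "{u, hd p} \<in> edges G" "vertex_path G (hd p) v p"
    by (auto simp: vertex_path_Cons)
  show ?case
  proof (cases "hd p \<in> D")
    case True
    with p Cons.prems show ?thesis by (intro exI[of _ "[]"]) (cases p; auto)
  next
    case False
    with Cons.IH[OF p(4)] Cons.prems obtain q x y r
      where "p = q @ x # y # r" "x \<notin> D" "y \<in> D" "{x, y} \<in> edges G"
      by auto
    then show ?thesis by (intro exI[of _ "a # q"]) auto
  qed
qed

lemma connected_imp_vertex_path:
  assumes "\<And>e. e \<in> edges G \<Longrightarrow> e \<subseteq> verts G" "u \<in> verts G"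
    and "(\<lambda>a b. {a, b} \<in> edges G)\<^sup>*\<^sup>* u v"
  shows "\<exists>p. vertex_path G u v p"
  using assms(3)
proof (induction rule: rtranclp_induct)
  case base
  show ?case using assms(2) by (intro exI[of _ "[u]"]) (simp add: vertex_path_def)
next
  case (step v w)
  then obtain p where p: "vertex_path G u v p" by blast
  have w: "w \<in> verts G" using assms(1) step.hyps(2) by blast
  show ?case
  proof (cases "w \<in> set p")
    case True
    then obtain q r where q: "p = q @ w # r" by (auto simp: in_set_conv_decomp)
    with p have "vertex_path G u w (q @ [w])"
      by (auto simp: vertex_path_def successively_append_iff hd_append)
    then show ?thesis by blast
  next
    case False
    with p w step.hyps(2) have "vertex_path G u w (p @ [w])"
      by (auto simp: vertex_path_def successively_append_iff)
    then show ?thesis by blast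
  qed
qed

text \<open>A set \<open>D\<close> that an edge from \<open>u\<close> to \<open>b\<close> separates from \<open>u\<close> forces every simple path from \<open>u\<close>
  into \<open>D\<close> to start with this edge, because it can meet \<open>u\<close> only at its start.  So simple paths
  are determined step by step.\<close>

lemma treeI:
  assumes nonempty: "verts G \<noteq> {}"
    and edge: "\<And>e. e \<in> edges G \<Longrightarrow> e \<subseteq> verts G \<and> card e = 2"
    and conn: "\<And>u v. u \<in> verts G \<Longrightarrow> v \<in> verts G \<Longrightarrow> (\<lambda>a b. {a, b} \<in> edges G)\<^sup>*\<^sup>* u v"
    and separate: "\<And>u v. u \<in> verts G \<Longrightarrow> v \<in> verts G \<Longrightarrow> u \<noteq> v \<Longrightarrow>
      \<exists>b D. v \<in> D \<and> u \<notin> D \<and> (\<forall>x y. {x, y} \<in> edges G \<longrightarrow> x \<notin> D \<longrightarrow> y \<in> D \<longrightarrow> x = u \<and> y = b)"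
  shows "tree G"
proof -
  have unique: "p = q" if "vertex_path G u v p" "vertex_path G u v q" for u v p q
    using that
  proof (induction p arbitrary: u q)
    case Nil
    then show ?case by (simp add: vertex_path_def)
  next
    case (Cons a p)
    from Cons.prems(2) obtain q' where q: "q = u # q'"
      by (cases q) (auto simp: vertex_path_def)
    have a: "a = u" and u: "u \<in> verts G" using Cons.prems(1) by (auto simp: vertex_path_Cons)
    show ?case
    proof (cases "u = v")
      case True
      have "v \<in> set r" if "r \<noteq> []" "vertex_path G (hd r) v r" for r
        using that by (auto simp: vertex_path_def)
      with True Cons.prems q a show ?thesis by (auto simp: vertex_path_Cons)
    next
      case False
      have v: "v \<in> verts G"
        using Cons.prems(1) unfolding vertex_path_def by (metis last_in_set subsetD)
      from separate[OF u v False] obtain b D where D: "v \<in> D" "u \<notin> D"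
        "\<And>x y. {x, y} \<in> edges G \<Longrightarrow> x \<notin> D \<Longrightarrow> y \<in> D \<Longrightarrow> x = u \<and> y = b" by blast
      have start: "r \<noteq> [] \<and> hd r = b" if path: "vertex_path G u v (u # r)" for r
      proof -
        obtain s x y t where s: "u # r = s @ x # y # t" "x \<notin> D" "y \<in> D" "{x, y} \<in> edges G"
          using vertex_path_crossing[OF path D(2) D(1)] by blast
        then have "x = u" "y = b" using D(3) by blast+
        moreover have "distinct (u # r)" using path by (simp only: vertex_path_def)
        ultimately show ?thesis using s(1) by (cases s) auto
      qed
      have "hd p = b" "hd q' = b" "p \<noteq> []" "q' \<noteq> []"
        using start Cons.prems q a by blast+
      then have "vertex_path G b v p" "vertex_path G b v q'"
        using Cons.prems q a by (auto simp: vertex_path_Cons)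
      then have "p = q'" by (rule Cons.IH)
      with q a show ?thesis by simp
    qed
  qed
  show ?thesis
    unfolding tree_def
    using nonempty edge unique connected_imp_vertex_path[of G] conn by (auto intro!: ex_ex1I)
qed

lemma connected_subgraph_tree:
  assumes G: "tree G"
    and sub: "verts S \<subseteq> verts G" "edges S \<subseteq> edges G" "\<And>e. e \<in> edges S \<Longrightarrow> e \<subseteq> verts S"
    and z: "z \<in> verts S"
    and conn: "\<And>u. u \<in> verts S \<Longrightarrow> (\<lambda>a b. {a, b} \<in> edges S)\<^sup>*\<^sup>* u z"
  shows "tree S"
proof -
  have path: "vertex_path G u v p" if "vertex_path S u v p" for u v p
    using that sub(1,2) by (auto simp: vertex_path_def elim!: successively_mono)
  have sym: "symp (\<lambda>a b. {a, b} \<in> edges S)" by (simp add: symp_def insert_commute)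
  have "(\<lambda>a b. {a, b} \<in> edges S)\<^sup>*\<^sup>* u v" if "u \<in> verts S" "v \<in> verts S" for u v
    using conn[OF that(1)] conn[OF that(2)] symp_rtranclp[OF sym]
    by (meson rtranclp_trans sympD)
  then have "\<exists>p. vertex_path S u v p" if "u \<in> verts S" "v \<in> verts S" for u v
    using connected_imp_vertex_path[of S u v] sub(3) that by blast
  moreover have "p = q"
    if "u \<in> verts S" "v \<in> verts S" "vertex_path S u v p" "vertex_path S u v q" for u v p q
    using G path[OF that(3)] path[OF that(4)] that(1,2) sub(1) unfolding tree_def by (metis subsetD)
  ultimately show ?thesis
    using G sub(2,3) z unfolding tree_def by (auto intro!: ex_ex1I)
qed

section \<open>Reduced words\<close>

text \<open>The letter \<open>Out j\<close> is the \<open>j\<close>-th generator of the free group of rank three and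
  \<open>In j\<close> is its inverse.  A word is written with its last letter at the head of the list, so
  \<open>mul a w\<close> is the product of \<open>w\<close> with \<open>a\<close> on the right.\<close>

datatype letter = Out 3 | In 3

instance letter :: countable
  by countable_datatype

fun inv_letter :: "letter \<Rightarrow> letter" where
  "inv_letter (Out j) = In j"
| "inv_letter (In j) = Out j"

definition reduced :: "letter list \<Rightarrow> bool" where
  "reduced w \<longleftrightarrow> successively (\<lambda>a b. b \<noteq> inv_letter a) w"

fun mul :: "letter \<Rightarrow> letter list \<Rightarrow> letter list" where
  "mul a [] = [a]"
| "mul a (b # w) = (if b = inv_letter a then w else a # b # w)"

lemma inv_letter_inv [simp]: "inv_letter (inv_letter a) = a"
  by (cases a) simp_all

lemma reduced_simps [simp]:
  "reduced []"
  "reduced [a]"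
  "reduced (a # b # w) \<longleftrightarrow> b \<noteq> inv_letter a \<and> reduced (b # w)"
  by (auto simp: reduced_def)

lemma reduced_tl: "reduced (a # w) \<Longrightarrow> reduced w"
  by (cases w) auto

lemma mul_reduced: "reduced w \<Longrightarrow> reduced (mul a w)"
  by (cases w) (auto dest: reduced_tl)

lemma mul_Cons: "reduced (a # w) \<Longrightarrow> mul a w = a # w"
  by (cases w) auto

lemma mul_inv_mul: "reduced w \<Longrightarrow> mul (inv_letter a) (mul a w) = w"
  by (cases w) (auto simp: mul_Cons)

lemma length_mul: "length (mul a w) = Suc (length w) \<or> Suc (length (mul a w)) = length w"
  by (cases w) auto

lemma mul_neq: "mul a w \<noteq> w"
  using length_mul[of a w] by auto

lemma mul_eq_iff: "mul a w = mul b w \<longleftrightarrow> a = b"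
proof (cases w)
  case (Cons c v)
  have "a = b" if "inv_letter a = inv_letter b"
    using that by (metis inv_letter_inv)
  moreover have "a # c # v \<noteq> v" "b # c # v \<noteq> v"
    by (metis length_Cons n_not_Suc_n Suc_n_not_le_n le_SucI order_refl)+
  ultimately show ?thesis using Cons by auto
qed simp

lemma mul_cases: "mul a w = a # w \<or> w = inv_letter a # mul a w"
  by (cases w) auto

subsection \<open>The vertices and the arcs\<close>

definition V :: "nat set" where
  "V = to_nat ` {w. reduced w}"

definition origin :: nat where
  "origin = to_nat ([] :: letter list)"

definition act :: "letter \<Rightarrow> nat \<Rightarrow> nat" where
  "act a m = to_nat (mul a (from_nat m))"

lemma V_iff: "m \<in> V \<longleftrightarrow> (\<exists>w. reduced w \<and> m = to_nat w)"
  by (auto simp: V_def)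

lemma act_to_nat: "act a (to_nat w) = to_nat (mul a w)"
  by (simp add: act_def)

lemma origin_in_V: "origin \<in> V"
  by (auto simp: origin_def V_iff intro: reduced_simps)

lemma act_in_V: "m \<in> V \<Longrightarrow> act a m \<in> V"
  by (auto simp: V_iff act_to_nat intro: mul_reduced)

lemma act_inv_act: "m \<in> V \<Longrightarrow> act (inv_letter a) (act a m) = m"
  by (auto simp: V_iff act_to_nat mul_inv_mul)

lemma act_neq: "m \<in> V \<Longrightarrow> act a m \<noteq> m"
  by (auto simp: V_iff act_to_nat mul_neq)

lemma act_eq_iff: "m \<in> V \<Longrightarrow> act a m = act b m \<longleftrightarrow> a = b"
  by (auto simp: V_iff act_to_nat mul_eq_iff)

lemma V_induct [consumes 1, case_names origin act]:
  assumes "m \<in> V" "P origin" "\<And>a m. m \<in> V \<Longrightarrow> P m \<Longrightarrow> P (act a m)"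
  shows "P m"
proof -
  have "P (to_nat w)" if "reduced w" for w :: "letter list"
    using that
  proof (induction w)
    case Nil
    show ?case using assms(2) by (simp add: origin_def)
  next
    case (Cons a w)
    then have "P (act a (to_nat w))" using assms(3) by (auto simp: V_iff dest: reduced_tl)
    then show ?case using Cons.prems by (simp add: act_to_nat mul_Cons)
  qed
  with assms(1) show ?thesis by (auto simp: V_iff)
qed

definition X :: "nat graph" where
  "X = \<lparr>verts = V, edges = {{m, act a m} | m a. m \<in> V}\<rparr>"

lemma verts_X [simp]: "verts X = V"
  by (simp add: X_def)

lemma edges_X: "edges X = {{m, act a m} | m a. m \<in> V}"
  by (simp add: X_def)

lemma adjacent_iff: "{m, n} \<in> edges X \<longleftrightarrow> m \<in> V \<and> (\<exists>a. n = act a m)"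
proof
  assume "{m, n} \<in> edges X"
  then obtain k a where k: "k \<in> V" "{m, n} = {k, act a k}" by (auto simp: edges_X)
  then consider "m = k" "n = act a k" | "m = act a k" "n = k" by (auto simp: doubleton_eq_iff)
  then show "m \<in> V \<and> (\<exists>a. n = act a m)"
    by cases (use k in \<open>auto simp: act_in_V intro: act_inv_act[symmetric]\<close>)
qed (auto simp: edges_X)

text \<open>A neighbour of a word \<open>u\<close> is either \<open>a # u\<close> for a letter \<open>a\<close> or the tail of \<open>u\<close>.  So
  removing the edge between \<open>u\<close> and \<open>a # u\<close> separates the words with suffix \<open>a # u\<close> from all
  others, which is the criterion \<open>treeI\<close>.\<close>

lemma tree_X: "tree X"
proof (rule treeI)
  show "verts X \<noteq> {}" using origin_in_V by auto
next
  fix e assume "e \<in> edges X"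
  then obtain m a where "m \<in> V" "e = {m, act a m}" by (auto simp: edges_X)
  then show "e \<subseteq> verts X \<and> card e = 2"
    using act_neq[of m a] act_in_V[of m a] by simp
next
  let ?R = "\<lambda>a b. {a, b} \<in> edges X"
  have to_origin: "?R\<^sup>*\<^sup>* u origin" if "u \<in> V" for u
    using that
  proof (induction rule: V_induct)
    case (act a m)
    then have "?R (act a m) m" by (auto simp: edges_X insert_commute[of "act a m"])
    with act show ?case by (meson converse_rtranclp_into_rtranclp)
  qed simp
  have sym: "symp ?R" unfolding symp_def by (metis insert_commute)
  fix u v assume "u \<in> verts X" "v \<in> verts X"
  then have "?R\<^sup>*\<^sup>* u origin" "?R\<^sup>*\<^sup>* origin v"
    using to_origin sympD[OF symp_rtranclp[OF sym]] by simp_all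
  then show "?R\<^sup>*\<^sup>* u v" by (rule rtranclp_trans)
next
  fix u v assume "u \<in> verts X" "v \<in> verts X" "u \<noteq> v"
  then obtain p q where p: "reduced p" "u = to_nat p" and q: "reduced q" "v = to_nat q"
    and "p \<noteq> q"
    by (auto simp: V_iff)
  have cross: "\<exists>w a. reduced (a # w) \<and> (x = to_nat w \<and> y = to_nat (a # w) \<or> x = to_nat (a # w) \<and> y = to_nat w)"
    if "{x, y} \<in> edges X" for x y
  proof -
    from that obtain w a where w: "reduced w" "x = to_nat w" "y = to_nat (mul a w)"
      unfolding adjacent_iff by (auto simp: V_iff act_to_nat)
    then show ?thesis using mul_cases[of a w] mul_reduced[of w a] by metis
  qed
  show "\<exists>b D. v \<in> D \<and> u \<notin> D \<and> (\<forall>x y. {x, y} \<in> edges X \<longrightarrow> x \<notin> D \<longrightarrow> y \<in> D \<longrightarrow> x = u \<and> y = b)"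
  proof (cases "suffix p q")
    case True
    with \<open>p \<noteq> q\<close> obtain a r where r: "q = r @ a # p"
      by (metis append_Nil append_assoc append_Cons rev_exhaust suffixE append_Nil2)
    let ?D = "to_nat ` {w. suffix (a # p) w}"
    have "x = u \<and> y = to_nat (a # p)" if "{x, y} \<in> edges X" "x \<notin> ?D" "y \<in> ?D" for x y
      using cross[OF that(1)] that(2,3) p by (auto simp: inj_image_mem_iff[OF inj_to_nat] suffix_Cons)
    moreover have "v \<in> ?D" using q r by (auto simp: suffix_def)
    moreover have "u \<notin> ?D" using p by (auto simp: suffix_def)
    ultimately show ?thesis by (intro exI[of _ "to_nat (a # p)"] exI[of _ ?D]) simp
  next
    case False
    then obtain a r where r: "p = a # r" by (cases p) auto
    let ?D = "to_nat ` {w. \<not> suffix p w}"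
    have "x = u \<and> y = to_nat r" if "{x, y} \<in> edges X" "x \<notin> ?D" "y \<in> ?D" for x y
      using cross[OF that(1)] that(2,3) p r by (auto simp: inj_image_mem_iff[OF inj_to_nat] suffix_Cons)
    moreover have "v \<in> ?D" using q False by auto
    moreover have "u \<notin> ?D" using p by auto
    ultimately show ?thesis by (intro exI[of _ "to_nat r"] exI[of _ ?D]) simp
  qed
qed

section \<open>Symmetries\<close>

lemma inv_letter_eq_iff: "a = inv_letter b \<longleftrightarrow> b = inv_letter a"
  by auto

lemma three_cases: "(j :: 3) = 0 \<or> j = 1 \<or> j = 2"
proof (cases j rule: bit1_cases)
  case (of_int z)
  then have "z = 0 \<or> z = 1 \<or> z = 2" by auto
  with of_int show ?thesis by auto
qed

definition arc :: "nat \<Rightarrow> nat \<Rightarrow> bool" where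
  "arc x y \<longleftrightarrow> x \<in> V \<and> (\<exists>j. y = act (Out j) x)"

definition turn :: "nat \<Rightarrow> nat \<Rightarrow> nat \<Rightarrow> bool" where
  "turn x y z \<longleftrightarrow> x \<in> V \<and> (\<exists>j. y = act (Out j) x \<and> z = act (Out (j + 1)) x)"

text \<open>The labels of the out-neighbours may be rotated by an amount \<open>s\<close> that depends on the vertex, and
  nothing is prescribed for the in-neighbours.\<close>

definition symmetry :: "(nat \<Rightarrow> nat) \<Rightarrow> bool" where
  "symmetry f \<longleftrightarrow> bij_betw f V V \<and> (\<forall>x\<in>V. \<exists>s. \<forall>j. f (act (Out j) x) = act (Out (j + s)) (f x))"

lemma symmetry_in_V: "symmetry f \<Longrightarrow> x \<in> V \<Longrightarrow> f x \<in> V"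
  by (auto simp: symmetry_def bij_betw_def)

lemma symmetry_inj: "symmetry f \<Longrightarrow> inj_on f V"
  by (auto simp: symmetry_def bij_betw_def)

lemma symmetry_arc: "symmetry f \<Longrightarrow> arc x y \<Longrightarrow> arc (f x) (f y)"
  using symmetry_in_V[of f x] by (force simp: symmetry_def arc_def)

lemma symmetry_turn: "symmetry f \<Longrightarrow> turn x y z \<Longrightarrow> turn (f x) (f y) (f z)"
proof -
  assume f: "symmetry f" and t: "turn x y z"
  then obtain j where j: "x \<in> V" "y = act (Out j) x" "z = act (Out (j + 1)) x"
    by (auto simp: turn_def)
  with f obtain s where "\<And>j. f (act (Out j) x) = act (Out (j + s)) (f x)"
    by (auto simp: symmetry_def)
  with j f show ?thesis by (auto simp: turn_def symmetry_in_V add_ac)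
qed

lemma symmetry_compose: "symmetry f \<Longrightarrow> symmetry g \<Longrightarrow> symmetry (f \<circ> g)"
  unfolding symmetry_def
proof (intro conjI ballI)
  assume f: "bij_betw f V V \<and> (\<forall>x\<in>V. \<exists>s. \<forall>j. f (act (Out j) x) = act (Out (j + s)) (f x))"
    and g: "bij_betw g V V \<and> (\<forall>x\<in>V. \<exists>s. \<forall>j. g (act (Out j) x) = act (Out (j + s)) (g x))"
  then show "bij_betw (f \<circ> g) V V" using bij_betw_trans by blast
  fix x assume "x \<in> V"
  with g obtain s where s: "\<And>j. g (act (Out j) x) = act (Out (j + s)) (g x)" by blast
  from \<open>x \<in> V\<close> g have "g x \<in> V" by (auto simp: bij_betw_def)
  with f obtain t where "\<And>j. f (act (Out j) (g x)) = act (Out (j + t)) (f (g x))" by blast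
  with s show "\<exists>s. \<forall>j. (f \<circ> g) (act (Out j) x) = act (Out (j + s)) ((f \<circ> g) x)"
    by (intro exI[of _ "s + t"]) (simp add: add_ac)
qed

lemma symmetry_inverse:
  assumes f: "symmetry f"
  shows "symmetry (inv_into V f)"
  unfolding symmetry_def
proof (intro conjI ballI)
  show "bij_betw (inv_into V f) V V"
    using f by (auto simp: symmetry_def intro: bij_betw_inv_into)
  fix y assume "y \<in> V"
  then obtain x where x: "x \<in> V" "y = f x"
    using f unfolding symmetry_def by (metis bij_betw_iff_bijections)
  then obtain s where s: "\<And>j. f (act (Out j) x) = act (Out (j + s)) y"
    using f by (auto simp: symmetry_def)
  have "inv_into V f (act (Out j) y) = act (Out (j - s)) x" for j
    using s[of "j - s"] x f by (metis act_in_V diff_add_cancel inv_into_f_eq symmetry_inj)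
  then show "\<exists>s. \<forall>j. inv_into V f (act (Out j) y) = act (Out (j + s)) (inv_into V f y)"
    using x f by (intro exI[of _ "- s"]) (simp add: inv_into_f_f symmetry_inj)
qed

lemma inv_symmetry:
  assumes "symmetry f" "x \<in> V"
  shows "f (inv_into V f x) = x" "inv_into V f (f x) = x"
  using assms by (auto simp: symmetry_def bij_betw_def f_inv_into_f inv_into_f_f)

subsection \<open>Translations\<close>

definition translation :: "(nat \<Rightarrow> nat) \<Rightarrow> bool" where
  "translation f \<longleftrightarrow> bij_betw f V V \<and> (\<forall>x\<in>V. \<forall>a. f (act a x) = act a (f x))"

lemma translation_symmetry: "translation f \<Longrightarrow> symmetry f"
  unfolding translation_def symmetry_def by (auto intro!: exI[of _ 0])

lemma translation_id: "translation id"
  by (simp add: translation_def)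

lemma translation_compose: "translation f \<Longrightarrow> translation g \<Longrightarrow> translation (f \<circ> g)"
  unfolding translation_def by (auto intro: bij_betw_trans simp: bij_betw_apply)

lemma translation_inverse:
  assumes f: "translation f"
  shows "translation (inv_into V f)"
  unfolding translation_def
proof (intro conjI ballI allI)
  show "bij_betw (inv_into V f) V V"
    using f by (auto simp: translation_def intro: bij_betw_inv_into)
  fix y a assume "y \<in> V"
  then obtain x where x: "x \<in> V" "y = f x"
    using f unfolding translation_def by (metis bij_betw_iff_bijections)
  then have "f (act a x) = act a y"
    using f by (auto simp: translation_def)
  then show "inv_into V f (act a y) = act a (inv_into V f y)"
    using x f inv_symmetry(2)[OF translation_symmetry[OF f]] by (metis act_in_V)
qed

text \<open>Translations act freely: they are determined along every path by the image of its start.\<close>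

lemma translation_determined:
  assumes f: "translation f" and g: "translation g" and u: "u \<in> V" "f u = g u" and x: "x \<in> V"
  shows "f x = g x"
proof -
  have step: "f (act a m) = g (act a m) \<longleftrightarrow> f m = g m" if "m \<in> V" for a m
  proof -
    have "f m \<in> V" "g m \<in> V"
      using that symmetry_in_V translation_symmetry f g by blast+
    then show ?thesis using that f g act_inv_act unfolding translation_def by metis
  qed
  have "f m = g m \<longleftrightarrow> f origin = g origin" if "m \<in> V" for m
    using that by (induction rule: V_induct) (auto simp: step)
  with u x show ?thesis by blast
qed

text \<open>Left multiplication by a letter acts on the other end of a word than \<open>mul\<close>.  It is obtained by
  reading the word as a path that starts at this letter instead of at the empty word.\<close>

lemma translation_from_origin_to_neighbour: "\<exists>f. translation f \<and> f origin = act a origin"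
proof -
  let ?L = "\<lambda>a w. foldr mul w [a]"
  have red: "reduced (?L a w)" for a w
    by (induction w) (auto intro: mul_reduced)
  have comm: "?L a (mul b w) = mul b (?L a w)" for a b w
  proof (cases w)
    case (Cons c w')
    then show ?thesis
      using mul_inv_mul[OF red[of w' a], of c] by auto
  qed simp
  have inv: "?L (inv_letter a) (?L a w) = w" if "reduced w" for a w
    using that
  proof (induction w)
    case (Cons b w)
    then have "?L (inv_letter a) (mul b (?L a w)) = mul b w"
      using reduced_tl by (simp add: comm del: foldr.simps)
    with Cons.prems show ?case by (simp add: mul_Cons)
  qed simp
  define f where "f a m = to_nat (?L a (from_nat m))" for a m
  have V: "f a m \<in> V" for a m using red by (auto simp: f_def V_iff)
  have ff: "f (inv_letter a) (f a m) = m" if "m \<in> V" for a m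
    using that inv by (auto simp: f_def V_iff)
  have "bij_betw (f a) V V"
    using V ff[of _ a] ff[of _ "inv_letter a"]
    by (intro bij_betw_byWitness[where f' = "f (inv_letter a)"]) auto
  moreover have "f a (act b m) = act b (f a m)" if "m \<in> V" for b m
    using that comm by (auto simp: f_def V_iff act_to_nat)
  moreover have "f a origin = act a origin"
    by (simp add: f_def origin_def act_to_nat)
  ultimately show ?thesis unfolding translation_def by blast
qed

lemma translation_transitive:
  assumes "u \<in> V" "v \<in> V"
  shows "\<exists>f. translation f \<and> f u = v"
proof -
  have from_origin: "\<exists>f. translation f \<and> f origin = v" if "v \<in> V" for v
    using that
  proof (induction rule: V_induct)
    case origin
    show ?case using translation_id by force
  next
    case (act a m)
    then obtain f g where f: "translation f" "f origin = m"
      and g: "translation g" "g origin = act a origin"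
      using translation_from_origin_to_neighbour by blast
    then have "(f \<circ> g) origin = act a m"
      using origin_in_V by (simp add: translation_def)
    with f g show ?case using translation_compose by blast
  qed
  obtain f g where f: "translation f" "f origin = u" and g: "translation g" "g origin = v"
    using from_origin assms by meson
  then have "(g \<circ> inv_into V f) u = v"
    using inv_symmetry(2)[OF translation_symmetry[OF f(1)] origin_in_V] by simp
  with f g show ?thesis using translation_compose translation_inverse by blast
qed

subsection \<open>Symmetries that fix a vertex\<close>

text \<open>A permutation of the letters is prescribed at every vertex, and the image of a path that starts
  at the origin is read off step by step.  Steps back must become steps back.\<close>

primrec portrait_map :: "(letter list \<Rightarrow> letter \<Rightarrow> letter) \<Rightarrow> letter list \<Rightarrow> letter list" where
  "portrait_map \<kappa> [] = []"
| "portrait_map \<kappa> (a # w) = \<kappa> w a # portrait_map \<kappa> w"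

lemma portrait_symmetry:
  assumes bij: "\<And>w. bij (\<kappa> w)"
    and backtrack: "\<And>b w. \<kappa> (b # w) (inv_letter b) = inv_letter (\<kappa> w b)"
    and shift: "\<And>w. \<exists>s. \<forall>j. \<kappa> w (Out j) = Out (j + s)"
  shows "\<exists>f. symmetry f \<and> f origin = origin \<and> (\<forall>a. f (act a origin) = act (\<kappa> [] a) origin)"
proof -
  let ?p = "portrait_map \<kappa>"
  have neq: "\<kappa> (b # w) a = inv_letter (\<kappa> w b) \<longleftrightarrow> a = inv_letter b" for a b w
    using bij[of "b # w"] backtrack[of b w] by (metis bij_def inj_def)
  have red: "reduced (?p w) \<longleftrightarrow> reduced w" for w
  proof (induction w)
    case (Cons a w)
    show ?case
    proof (cases w)
      case (Cons b v)
      have "\<kappa> v b = inv_letter (\<kappa> (b # v) a) \<longleftrightarrow> b = inv_letter a"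
        using neq[of b v a] by (simp add: inv_letter_eq_iff[of "\<kappa> v b"] inv_letter_eq_iff[of b])
      then show ?thesis using Cons Cons.IH by simp
    qed simp
  qed simp
  have mul: "?p (mul a w) = mul (\<kappa> w a) (?p w)" for a w
  proof (cases w)
    case (Cons b v)
    have "\<kappa> v b = inv_letter (\<kappa> (b # v) a) \<longleftrightarrow> b = inv_letter a"
      using neq[of b v a] by (simp add: inv_letter_eq_iff[of "\<kappa> v b"] inv_letter_eq_iff[of b])
    then show ?thesis using Cons by simp
  qed simp
  have inj: "v = w" if "?p v = ?p w" for v w
    using that
  proof (induction v arbitrary: w)
    case Nil
    then show ?case by (cases w) auto
  next
    case (Cons a v)
    then obtain b u where "w = b # u" by (cases w) auto
    with Cons bij[of u] show ?case by (auto simp: bij_def inj_def)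
  qed
  have surj: "\<exists>v. ?p v = w" for w
  proof (induction w)
    case Nil
    show ?case by (intro exI[of _ "[]"]) simp
  next
    case (Cons a w)
    then obtain v where "?p v = w" by blast
    moreover obtain b where "a = \<kappa> v b" using bij[of v] by (metis bij_pointE)
    ultimately show ?case by (intro exI[of _ "b # v"]) simp
  qed
  define f where "f m = to_nat (?p (from_nat m))" for m
  have "bij_betw f V V"
    unfolding bij_betw_def
  proof
    show "inj_on f V" by (auto simp: inj_on_def f_def V_iff inj)
    have "?p ` {w. reduced w} = {w. reduced w}"
      using red surj by (auto simp: image_iff) metis
    then show "f ` V = V"
      by (simp add: V_def f_def image_image flip: image_image[of to_nat ?p])
  qed
  moreover have act: "f (act a (to_nat w)) = act (\<kappa> w a) (f (to_nat w))" for a w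
    by (simp add: f_def act_to_nat mul)
  have "\<exists>s. \<forall>j. f (act (Out j) x) = act (Out (j + s)) (f x)" if "x \<in> V" for x
    using that shift act by (metis V_iff)
  moreover have "f origin = origin" by (simp add: f_def origin_def)
  ultimately show ?thesis
    using act[of _ "[]"] unfolding symmetry_def by (auto simp: origin_def)
qed

primrec shift :: "3 \<Rightarrow> letter \<Rightarrow> letter" where
  "shift s (Out j) = Out (j + s)"
| "shift s (In j) = In (j + s)"

lemma shift_shift: "shift s (shift t a) = shift (t + s) a"
  by (cases a) (auto simp: add_ac)

lemma shift_0: "shift 0 a = a"
  by (cases a) auto

lemma bij_shift: "bij (shift s)"
  by (rule o_bij[of "shift (- s)"]) (auto simp: fun_eq_iff shift_shift shift_0)

lemma shift_inv_letter: "shift s (inv_letter a) = inv_letter (shift s a)"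
  by (cases a) auto

text \<open>Under the exchange of the letters \<open>In j\<close> and \<open>In k\<close> at the origin, a step back from the \<open>j\<close>-th
  in-neighbour to the origin, which reads \<open>Out j\<close>, must become \<open>Out k\<close>.  A cyclic shift of the generators
  that is used in the whole branch achieves this.\<close>

definition swap_portrait :: "3 \<Rightarrow> 3 \<Rightarrow> letter list \<Rightarrow> letter \<Rightarrow> letter" where
  "swap_portrait j k w =
     (if w = [] then id(In j := In k, In k := In j)
      else if last w = In j then shift (k - j)
      else if last w = In k then shift (j - k)
      else id)"

lemma symmetry_at_origin_swap:
  assumes "j \<noteq> k"
  shows "\<exists>f. symmetry f \<and> f origin = origin \<and> f (act (In j) origin) = act (In k) origin \<and>
    f (act (In k) origin) = act (In j) origin"
proof -
  have "bij (swap_portrait j k w)" for w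
  proof -
    have "bij (id(In j := In k, In k := In j))"
      by (rule o_bij[of "id(In j := In k, In k := In j)"]) (use assms in \<open>auto simp: fun_eq_iff\<close>)
    then show ?thesis by (simp add: swap_portrait_def bij_shift)
  qed
  moreover have "swap_portrait j k (b # w) (inv_letter b) = inv_letter (swap_portrait j k w b)" for b w
    using assms by (cases b) (auto simp: swap_portrait_def shift_inv_letter)
  moreover have "\<exists>s. \<forall>i. swap_portrait j k w (Out i) = Out (i + s)" for w
  proof -
    have "\<forall>i. swap_portrait j k w (Out i) =
      Out (i + (if w = [] then 0 else if last w = In j then k - j else if last w = In k then j - k else 0))"
      by (simp add: swap_portrait_def)
    then show ?thesis by blast
  qed
  ultimately obtain f where "symmetry f" "f origin = origin"
    "\<And>a. f (act a origin) = act (swap_portrait j k [] a) origin"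
    using portrait_symmetry[of "swap_portrait j k"] by blast
  then show ?thesis using assms by (intro exI[of _ f]) (simp add: swap_portrait_def)
qed

lemma symmetry_at_origin_shift:
  "\<exists>f. symmetry f \<and> f origin = origin \<and> (\<forall>a. f (act a origin) = act (shift s a) origin)"
  by (rule portrait_symmetry[of "\<lambda>_. shift s"]) (auto simp: bij_shift shift_inv_letter)

text \<open>Conjugation by a translation carries the local action at the origin to any other vertex, because
  translations preserve labels.\<close>

lemma symmetry_move_origin:
  assumes f: "symmetry f" "f origin = origin" and v: "v \<in> V"
  shows "\<exists>g. symmetry g \<and> g v = v \<and>
    (\<forall>a b. f (act a origin) = act b origin \<longrightarrow> g (act a v) = act b v)"
proof -
  obtain t where t: "translation t" "t origin = v"
    using translation_transitive[OF origin_in_V v] by blast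
  let ?t' = "inv_into V t" and ?g = "t \<circ> f \<circ> inv_into V t"
  have act: "t (act a origin) = act a v" for a
    using t origin_in_V by (simp add: translation_def)
  have back_v: "?t' v = origin" and back_act: "?t' (act a v) = act a origin" for a
    using inv_symmetry(2)[OF translation_symmetry[OF t(1)]] origin_in_V act_in_V act t(2) by metis+
  have "symmetry ?g"
    using f(1) t(1) symmetry_compose symmetry_inverse translation_symmetry by blast
  with f t back_v back_act act show ?thesis by (intro exI[of _ ?g]) simp
qed

lemma ex_symmetry_swap:
  assumes "arc a v" "arc b v" "a \<noteq> b"
  shows "\<exists>f. symmetry f \<and> f v = v \<and> f a = b \<and> f b = a"
proof -
  have inn: "\<exists>j. x = act (In j) v" if "arc x v" for x
  proof -
    from that obtain j where "x \<in> V" "v = act (Out j) x" by (auto simp: arc_def)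
    then show ?thesis using act_inv_act[of x "Out j"] by (intro exI[of _ j]) simp
  qed
  obtain j k where jk: "a = act (In j) v" "b = act (In k) v" using inn assms by meson
  have v: "v \<in> V" using assms by (auto simp: arc_def act_in_V)
  have "j \<noteq> k" using jk assms(3) by auto
  then show ?thesis
    using symmetry_at_origin_swap symmetry_move_origin[OF _ _ v] jk by metis
qed

lemma ex_symmetry_rotation:
  assumes "arc v c" "arc v d"
  shows "\<exists>f. symmetry f \<and> f v = v \<and> f c = d"
proof -
  obtain j k where jk: "c = act (Out j) v" "d = act (Out k) v" and v: "v \<in> V"
    using assms by (auto simp: arc_def)
  obtain f where "symmetry f" "f origin = origin" "f (act (Out j) origin) = act (Out k) origin"
    using symmetry_at_origin_shift[of "k - j"] by auto
  then show ?thesis using symmetry_move_origin[OF _ _ v] jk by metis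
qed

section \<open>The tree with fins\<close>

lemma arc_in_V: "arc x y \<Longrightarrow> x \<in> V" "arc x y \<Longrightarrow> y \<in> V"
  by (auto simp: arc_def act_in_V)

lemma arc_neq: "arc x y \<Longrightarrow> x \<noteq> y"
  by (metis arc_def act_neq)

lemma adjacent_iff_arc: "{x, y} \<in> edges X \<longleftrightarrow> arc x y \<or> arc y x"
proof
  assume "{x, y} \<in> edges X"
  then obtain a where x: "x \<in> V" and y: "y = act a x" unfolding adjacent_iff by blast
  show "arc x y \<or> arc y x"
  proof (cases a)
    case (In j)
    with x y act_inv_act[of x a] act_in_V[of x a] have "y \<in> V" "x = act (Out j) y" by auto
    then have "arc y x" by (auto simp: arc_def)
    then show ?thesis ..
  qed (use x y in \<open>auto simp: arc_def\<close>)
next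
  have "{x, y} \<in> edges X" if "arc x y" for x y
    unfolding adjacent_iff using that by (auto simp: arc_def)
  moreover assume "arc x y \<or> arc y x"
  ultimately show "{x, y} \<in> edges X" by (metis insert_commute)
qed

lemma X_edge_subset: "e \<in> edges X \<Longrightarrow> e \<subseteq> V"
  by (auto simp: edges_X act_in_V)

lemma ex_other_arc: "arc x y \<Longrightarrow> \<exists>w. arc w y \<and> w \<noteq> x"
proof -
  assume "arc x y"
  then obtain j where x: "x \<in> V" "y = act (Out j) x" by (auto simp: arc_def)
  then have y: "y \<in> V" "x = act (In j) y" using act_inv_act[of x "Out j"] act_in_V by auto
  have "act (In (j + 1)) y \<noteq> x" using act_eq_iff[OF y(1)] y(2) by simp
  moreover have "arc (act (In (j + 1)) y) y"
    using act_inv_act[OF y(1), of "In (j + 1)"] act_in_V[OF y(1)] unfolding arc_def by (metis inv_letter.simps(2))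
  ultimately show ?thesis by blast
qed

lemma turn_arc: "turn x y z \<Longrightarrow> arc x y" "turn x y z \<Longrightarrow> arc x z"
  by (auto simp: turn_def arc_def)

lemma turn_neq: "turn x y z \<Longrightarrow> y \<noteq> z"
  by (auto simp: turn_def act_eq_iff)

lemma turn_unique: "turn x y z \<Longrightarrow> turn x y z' \<Longrightarrow> z = z'"
  by (auto simp: turn_def act_eq_iff)

lemma ex_turn: "arc x y \<Longrightarrow> \<exists>z. turn x y z"
  by (auto simp: turn_def arc_def)

lemma add_three: "(j :: 3) + 1 + 1 + 1 = j"
  using three_cases[of j] by auto

lemma turn_cycle: "turn x a b \<Longrightarrow> turn x b c \<Longrightarrow> turn x c a"
  using add_three by (auto simp: turn_def act_eq_iff)

lemma three_successors: "(i :: 3) = j \<or> i = j + 1 \<or> i = j + 1 + 1"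
  using three_cases[of i] three_cases[of j] by auto

lemma out_neighbours: "turn x a b \<Longrightarrow> turn x b c \<Longrightarrow> arc x d \<longleftrightarrow> d = a \<or> d = b \<or> d = c"
  using three_successors by (force simp: turn_def arc_def act_eq_iff add.assoc simp del: one_add_one)

lemma finite_neighbours: "finite {y. {x, y} \<in> edges X}"
proof -
  have "finite (UNIV :: 3 set)" by simp
  moreover have "{y. {x, y} \<in> edges X} \<subseteq> (\<lambda>j. act (Out j) x) ` UNIV \<union> (\<lambda>j. act (In j) x) ` UNIV"
    unfolding adjacent_iff using letter.exhaust by (auto simp: image_iff) metis
  ultimately show ?thesis by (metis finite_Un finite_imageI finite_subset)
qed

text \<open>The fins have to serve two purposes.  Every automorphism of the complex has to preserve the
  orientation of the tree and the cyclic orders of the out-neighbours, and for this the fin must not have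
  unwanted symmetries.  And the orbit of one vertex of a fin has to tell how an ordered pair of
  in-neighbours of a vertex is moved, and for this the fin contains two arcs \<open>w \<rightarrow> y \<leftarrow> x\<close> that enter
  the same vertex.  The arc \<open>x \<rightarrow> t\<close> that follows \<open>x \<rightarrow> y\<close> in the cyclic order records this order, and
  the star of arcs that leave \<open>w\<close> makes \<open>w\<close> the only vertex of degree three of the fin, so that the
  four vertices can be told apart.\<close>

datatype 'a corner = Corner 'a 'a 'a 'a

instance corner :: (countable) countable
  by countable_datatype

definition corners :: "nat corner set" where
  "corners = {Corner w y x t | w y x t. arc w y \<and> turn x y t \<and> w \<noteq> x}"

primrec fin_graph :: "nat corner \<Rightarrow> nat graph" where
  "fin_graph (Corner w y x t) =
     \<lparr>verts = {w, x, t} \<union> {z. arc w z}, edges = {{w, z} | z. arc w z} \<union> {{y, x}, {x, t}}\<rparr>"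

definition T :: "(nat, nat, nat) fin_data" where
  "T = \<lparr>base_tree = X, fin_index = to_nat ` corners, fin_tree = (\<lambda>i. fin_graph (from_nat i)),
     fin_map = (\<lambda>_ u. u)\<rparr>"

lemma T_simps [simp]:
  "base_tree T = X" "fin_index T = to_nat ` corners"
  "fin_tree T i = fin_graph (from_nat i)" "fin_map T i u = u"
  by (simp_all add: T_def)

lemma tree_X_no_cycle:
  assumes "vertex_path X u v (u # w # p)" "p \<noteq> []"
  shows "{u, v} \<notin> edges X"
proof
  assume e: "{u, v} \<in> edges X"
  have "u \<noteq> v" using assms by (auto simp: vertex_path_def)
  with e have "vertex_path X u v [u, v]"
    using X_edge_subset[OF e] by (auto simp: vertex_path_def)
  with assms tree_X have "[u, v] = u # w # p"
    unfolding tree_def by (metis hd_in_set last_in_set subsetD vertex_path_def)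
  with assms(2) show False by simp
qed

text \<open>The exclusions hold because \<open>w, y, x, t\<close> is a path in a tree, where chords would close a cycle.\<close>

lemma corner_distinct:
  assumes "(Corner w y x t) \<in> corners"
  shows "w \<noteq> y" "x \<noteq> y" "t \<noteq> y" "t \<noteq> x" "w \<noteq> x" "t \<noteq> w" "\<not> arc w x" "\<not> arc w t"
proof -
  from assms have a: "arc w y" "arc x y" "arc x t" "t \<noteq> y" "w \<noteq> x"
    by (auto simp: corners_def dest: turn_arc turn_neq)
  then show 1: "w \<noteq> y" "x \<noteq> y" "t \<noteq> y" "t \<noteq> x" "w \<noteq> x"
    by (auto dest: arc_neq)
  have V: "w \<in> V" "x \<in> V" "y \<in> V" "t \<in> V" using a arc_in_V by blast+
  have e: "{w, y} \<in> edges X" "{y, x} \<in> edges X" "{x, t} \<in> edges X"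
    unfolding adjacent_iff_arc using a by blast+
  have "vertex_path X w x [w, y, x]"
    using 1 V e unfolding vertex_path_def verts_X by simp
  from tree_X_no_cycle[OF this] have wx: "{w, x} \<notin> edges X" by simp
  then show "\<not> arc w x" unfolding adjacent_iff_arc by blast
  show tw: "t \<noteq> w" using wx e(3) by (metis insert_commute)
  have "vertex_path X w t [w, y, x, t]"
    using 1 tw V e unfolding vertex_path_def verts_X by auto
  from tree_X_no_cycle[OF this] show "\<not> arc w t" unfolding adjacent_iff_arc by auto
qed

lemma fin_graph_subgraph:
  assumes "q \<in> corners"
  shows "verts (fin_graph q) \<subseteq> V" "edges (fin_graph q) \<subseteq> edges X"
    "e \<in> edges (fin_graph q) \<Longrightarrow> e \<subseteq> verts (fin_graph q)"
proof -
  obtain w y x t where q: "q = (Corner w y x t)" by (cases q)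
  have a: "arc w y" "arc x y" "arc x t"
    using assms turn_arc by (auto simp: q corners_def)
  show "verts (fin_graph q) \<subseteq> V" using a arc_in_V by (auto simp: q)
  have "{y, x} \<in> edges X" "{x, t} \<in> edges X" "\<And>z. arc w z \<Longrightarrow> {w, z} \<in> edges X"
    unfolding adjacent_iff_arc using a by blast+
  then show "edges (fin_graph q) \<subseteq> edges X" by (auto simp: q)
  show "e \<in> edges (fin_graph q) \<Longrightarrow> e \<subseteq> verts (fin_graph q)" using a by (auto simp: q)
qed

lemma fin_graph_connected:
  assumes "(Corner w y x t) \<in> corners" "u \<in> verts (fin_graph (Corner w y x t))"
  shows "(\<lambda>a b. {a, b} \<in> edges (fin_graph (Corner w y x t)))\<^sup>*\<^sup>* u w"
proof -
  let ?R = "\<lambda>a b. {a, b} \<in> edges (fin_graph (Corner w y x t))"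
  have star: "?R\<^sup>*\<^sup>* z w" if "arc w z" for z
    using that by (intro r_into_rtranclp) auto
  have "arc w y" using assms(1) by (auto simp: corners_def)
  then have x: "?R\<^sup>*\<^sup>* x w"
    by (intro converse_rtranclp_into_rtranclp[OF _ star]) auto
  have "?R\<^sup>*\<^sup>* t w"
    by (intro converse_rtranclp_into_rtranclp[OF _ x]) auto
  with star x assms(2) show ?thesis by auto
qed

lemma tree_fin_graph: "q \<in> corners \<Longrightarrow> tree (fin_graph q)"
proof -
  assume q: "q \<in> corners"
  obtain w y x t where "q = (Corner w y x t)" by (cases q)
  with q show ?thesis
    using connected_subgraph_tree[OF tree_X, of "fin_graph q" w]
      fin_graph_subgraph[OF q] fin_graph_connected[of w y x t] by auto
qed

lemma tree_with_fins_T: "tree_with_fins T"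
proof -
  have "fin_map T i ` A = A" for i A by simp
  then show ?thesis
    unfolding tree_with_fins_def tree_embedding_def
    using tree_X tree_fin_graph fin_graph_subgraph(1,2)[THEN subsetD]
    by (auto simp: inj_on_def)
qed

subsection \<open>Cells\<close>

abbreviation fin_vertex :: "nat corner \<Rightarrow> nat \<Rightarrow> (nat, nat, nat) cvertex" where
  "fin_vertex q u \<equiv> Fin (to_nat q) u"

lemma base_vertices_T: "base_vertices T = Base ` V"
  by (simp add: base_vertices_def)

lemma vertices_T:
  "vertices T = Base ` V \<union> {fin_vertex q u | q u. q \<in> corners \<and> u \<in> verts (fin_graph q)}"
  unfolding vertices_def base_vertices_T by auto

lemma Base_in_vertices [simp]: "Base v \<in> vertices T \<longleftrightarrow> v \<in> V"
  by (auto simp: vertices_T)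

lemma Fin_in_vertices [simp]:
  "fin_vertex q u \<in> vertices T \<longleftrightarrow> q \<in> corners \<and> u \<in> verts (fin_graph q)"
  by (auto simp: vertices_T)

lemma base_edges_T: "base_edges T = {Base ` e | e. e \<in> edges X}"
  by (simp add: base_edges_def)

lemma cedges_T:
  "cedges T = {Base ` e | e. e \<in> edges X}
     \<union> {fin_vertex q ` e | q e. q \<in> corners \<and> e \<in> edges (fin_graph q)}
     \<union> {{Base u, fin_vertex q u} | q u. q \<in> corners \<and> u \<in> verts (fin_graph q)}"
  unfolding cedges_def base_edges_T by force

lemma squares_T:
  "squares T = {Base ` e \<union> fin_vertex q ` e | q e. q \<in> corners \<and> e \<in> edges (fin_graph q)}"
proof -
  have "squares T =
    {Base ` e \<union> Fin i ` e | i e. i \<in> to_nat ` corners \<and> e \<in> edges (fin_graph (from_nat i))}"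
    by (simp add: squares_def image_image)
  also have "\<dots> = (\<Union>q\<in>corners. (\<lambda>e. Base ` e \<union> fin_vertex q ` e) ` edges (fin_graph q))"
    (is "?L = ?R")
  proof (intro subset_antisym subsetI)
    fix s assume "s \<in> ?L"
    then obtain i e where "s = Base ` e \<union> Fin i ` e" "i \<in> to_nat ` corners"
      "e \<in> edges (fin_graph (from_nat i))" by blast
    then show "s \<in> ?R" by (elim imageE) (simp, blast)
  next
    fix s assume "s \<in> ?R"
    then obtain q e where "q \<in> corners" "e \<in> edges (fin_graph q)" "s = Base ` e \<union> fin_vertex q ` e"
      by blast
    then show "s \<in> ?L"
      by (intro CollectI exI[of _ "to_nat q"] exI[of _ e]) simp
  qed
  also have "\<dots> = {Base ` e \<union> fin_vertex q ` e | q e. q \<in> corners \<and> e \<in> edges (fin_graph q)}"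
    by auto
  finally show ?thesis .
qed

lemma cells_in_vertices:
  "e \<in> cedges T \<Longrightarrow> e \<subseteq> vertices T"
  "e \<in> squares T \<Longrightarrow> e \<subseteq> vertices T"
  "e \<in> base_edges T \<Longrightarrow> e \<subseteq> vertices T"
proof -
  have base: "Base ` d \<subseteq> vertices T" if "d \<in> edges X" for d
    using X_edge_subset[OF that] by auto
  have fin: "Base ` d \<subseteq> vertices T" "fin_vertex q ` d \<subseteq> vertices T"
    if "q \<in> corners" "d \<in> edges (fin_graph q)" for q d
    using base fin_graph_subgraph(2)[OF that(1)] fin_graph_subgraph(3)[OF that] that by auto
  have vertical: "{Base u, fin_vertex q u} \<subseteq> vertices T"
    if "q \<in> corners" "u \<in> verts (fin_graph q)" for q u
    using that fin_graph_subgraph(1)[OF that(1)] by auto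
  show "e \<in> base_edges T \<Longrightarrow> e \<subseteq> vertices T"
    unfolding base_edges_T using base by blast
  show "e \<in> cedges T \<Longrightarrow> e \<subseteq> vertices T"
    unfolding cedges_T by (elim UnE CollectE exE conjE) (use base fin vertical in \<open>simp_all del: insert_subset\<close>)
  show "e \<in> squares T \<Longrightarrow> e \<subseteq> vertices T"
    unfolding squares_T by (elim CollectE exE conjE) (use fin in simp)
qed

section \<open>Automorphisms\<close>

subsection \<open>Symmetries act on the complex\<close>

fun lift_vertex :: "(nat \<Rightarrow> nat) \<Rightarrow> (nat, nat, nat) cvertex \<Rightarrow> (nat, nat, nat) cvertex" where
  "lift_vertex f (Base u) = Base (f u)"
| "lift_vertex f (Fin i u) = fin_vertex (map_corner f (from_nat i)) (f u)"

definition lift :: "(nat \<Rightarrow> nat) \<Rightarrow> (nat, nat, nat) cvertex \<Rightarrow> (nat, nat, nat) cvertex" where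
  "lift f = restrict (lift_vertex f) (vertices T)"

lemma vertices_cases:
  assumes "v \<in> vertices T"
  obtains u where "u \<in> V" "v = Base u"
  | q u where "q \<in> corners" "u \<in> verts (fin_graph q)" "v = fin_vertex q u"
  using assms by (auto simp: vertices_T)

lemma symmetry_corner:
  assumes f: "symmetry f" and q: "q \<in> corners"
  shows "map_corner f q \<in> corners"
    and "u \<in> verts (fin_graph q) \<Longrightarrow> f u \<in> verts (fin_graph (map_corner f q))"
    and "e \<in> edges (fin_graph q) \<Longrightarrow> f ` e \<in> edges (fin_graph (map_corner f q))"
proof -
  obtain w y x t where c: "q = Corner w y x t" "arc w y" "turn x y t" "w \<noteq> x"
    using q by (auto simp: corners_def)
  then have "f w \<noteq> f x"
    using symmetry_inj[OF f] arc_in_V(1) turn_arc(1) by (metis inj_onD)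
  then show "map_corner f q \<in> corners"
    using c symmetry_arc[OF f] symmetry_turn[OF f] by (auto simp: corners_def)
  show "u \<in> verts (fin_graph q) \<Longrightarrow> f u \<in> verts (fin_graph (map_corner f q))"
    using c symmetry_arc[OF f] by auto
  show "e \<in> edges (fin_graph q) \<Longrightarrow> f ` e \<in> edges (fin_graph (map_corner f q))"
    using c symmetry_arc[OF f] by auto
qed

lemma symmetry_edge: "symmetry f \<Longrightarrow> e \<in> edges X \<Longrightarrow> f ` e \<in> edges X"
proof -
  assume f: "symmetry f" and e: "e \<in> edges X"
  then obtain x y where xy: "e = {x, y}" by (auto simp: edges_X)
  with e have "arc x y \<or> arc y x" using adjacent_iff_arc by simp
  then have "arc (f x) (f y) \<or> arc (f y) (f x)" using symmetry_arc[OF f] by blast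
  then have "{f x, f y} \<in> edges X" using adjacent_iff_arc by simp
  with xy show ?thesis by simp
qed

lemma lift_Base [simp]: "v \<in> V \<Longrightarrow> lift f (Base v) = Base (f v)"
  by (simp add: lift_def)

lemma lift_Fin [simp]:
  "q \<in> corners \<Longrightarrow> u \<in> verts (fin_graph q) \<Longrightarrow> lift f (fin_vertex q u) = fin_vertex (map_corner f q) (f u)"
  by (simp add: lift_def)

lemma lift_image_Base: "A \<subseteq> V \<Longrightarrow> lift f ` Base ` A = Base ` f ` A"
  unfolding image_image by (intro image_cong) auto

lemma lift_image_Fin:
  "q \<in> corners \<Longrightarrow> A \<subseteq> verts (fin_graph q) \<Longrightarrow>
     lift f ` fin_vertex q ` A = fin_vertex (map_corner f q) ` f ` A"
  unfolding image_image by (intro image_cong) auto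

lemma cedges_cases:
  assumes "e \<in> cedges T"
  obtains (base) d where "e = Base ` d" "d \<in> edges X"
    | (fin) q d where "e = fin_vertex q ` d" "q \<in> corners" "d \<in> edges (fin_graph q)"
    | (vertical) q u where "e = {Base u, fin_vertex q u}" "q \<in> corners" "u \<in> verts (fin_graph q)"
  using assms unfolding cedges_T by (elim UnE CollectE exE conjE) simp_all

lemma cedgesI:
  "d \<in> edges X \<Longrightarrow> Base ` d \<in> cedges T"
  "q \<in> corners \<Longrightarrow> d \<in> edges (fin_graph q) \<Longrightarrow> fin_vertex q ` d \<in> cedges T"
  "q \<in> corners \<Longrightarrow> u \<in> verts (fin_graph q) \<Longrightarrow> {Base u, fin_vertex q u} \<in> cedges T"
  unfolding cedges_T by (rule UnI1, rule UnI1, blast, rule UnI1, rule UnI2, blast, rule UnI2, blast)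

lemma base_edgesI: "d \<in> edges X \<Longrightarrow> Base ` d \<in> base_edges T"
  unfolding base_edges_T by blast

lemma squaresI:
  "q \<in> corners \<Longrightarrow> d \<in> edges (fin_graph q) \<Longrightarrow> Base ` d \<union> fin_vertex q ` d \<in> squares T"
  unfolding squares_T by blast

lemma lift_cells:
  assumes f: "symmetry f"
  shows "v \<in> vertices T \<Longrightarrow> lift f v \<in> vertices T"
    and "v \<in> base_vertices T \<Longrightarrow> lift f v \<in> base_vertices T"
    and "e \<in> base_edges T \<Longrightarrow> lift f ` e \<in> base_edges T"
    and "e \<in> cedges T \<Longrightarrow> lift f ` e \<in> cedges T"
    and "e \<in> squares T \<Longrightarrow> lift f ` e \<in> squares T"
proof -
  note sc = symmetry_corner[OF f]
  have base: "lift f ` Base ` e = Base ` f ` e" if "e \<in> edges X" for e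
    using lift_image_Base[OF X_edge_subset[OF that]] .
  have fin: "lift f ` fin_vertex q ` e = fin_vertex (map_corner f q) ` f ` e"
    if "q \<in> corners" "e \<in> edges (fin_graph q)" for q e
    using lift_image_Fin[OF that(1) fin_graph_subgraph(3)[OF that]] .
  show "v \<in> vertices T \<Longrightarrow> lift f v \<in> vertices T"
    by (erule vertices_cases) (auto simp: symmetry_in_V f sc)
  show "v \<in> base_vertices T \<Longrightarrow> lift f v \<in> base_vertices T"
    by (auto simp: base_vertices_T symmetry_in_V f)
  show "lift f ` e \<in> base_edges T" if e: "e \<in> base_edges T"
  proof -
    from e obtain d where "e = Base ` d" "d \<in> edges X" by (auto simp: base_edges_T)
    then show ?thesis using base symmetry_edge[OF f] by (simp add: base_edgesI)
  qed
  show "lift f ` e \<in> cedges T" if "e \<in> cedges T"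
    using that
  proof (cases rule: cedges_cases)
    case base
    then show ?thesis
      using lift_image_Base[OF X_edge_subset] symmetry_edge[OF f] by (simp add: cedgesI(1))
  next
    case (fin q d)
    then show ?thesis
      using lift_image_Fin[OF fin(2) fin_graph_subgraph(3)[OF fin(2,3)]] sc by (simp add: cedgesI(2))
  next
    case (vertical q u)
    then have "lift f ` e = {Base (f u), fin_vertex (map_corner f q) (f u)}"
      using fin_graph_subgraph(1)[of q] by auto
    then show ?thesis using vertical sc by (simp add: cedgesI(3))
  qed
  show "lift f ` e \<in> squares T" if e: "e \<in> squares T"
  proof -
    from e obtain q d where d: "e = Base ` d \<union> fin_vertex q ` d" "q \<in> corners" "d \<in> edges (fin_graph q)"
      unfolding squares_T by blast
    then have "lift f ` e = Base ` f ` d \<union> fin_vertex (map_corner f q) ` f ` d"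
      using fin_graph_subgraph(2)[OF d(2)] base[of d] fin[of q d] by (auto simp: image_Un)
    then show ?thesis using d sc by (simp add: squaresI)
  qed
qed

lemma lift_compose:
  assumes f: "symmetry f" and g: "symmetry g" and v: "v \<in> vertices T"
  shows "lift f (lift g v) = lift (f \<circ> g) v"
  using v
proof (rule vertices_cases)
  fix q u assume "q \<in> corners" "u \<in> verts (fin_graph q)" "v = fin_vertex q u"
  then show ?thesis using symmetry_corner[OF g, of q] by (simp add: corner.map_comp)
qed (simp add: symmetry_in_V g)

lemma lift_cong:
  assumes "\<And>v. v \<in> V \<Longrightarrow> f v = g v"
  shows "lift f = lift g"
proof
  fix v
  show "lift f v = lift g v"
  proof (cases "v \<in> vertices T")
    case True
    then show ?thesis
    proof (rule vertices_cases)
      fix q u assume q: "q \<in> corners" "u \<in> verts (fin_graph q)" "v = fin_vertex q u"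
      obtain w y x t where c: "q = Corner w y x t" "arc w y" "turn x y t"
        using q(1) by (auto simp: corners_def)
      then have "w \<in> V" "y \<in> V" "x \<in> V" "t \<in> V" "u \<in> V"
        using turn_arc arc_in_V fin_graph_subgraph(1) q by blast+
      then show ?thesis using q assms c by simp
    qed (simp add: assms)
  qed (simp add: lift_def)
qed

lemma lift_id: "v \<in> vertices T \<Longrightarrow> lift id v = v"
  by (erule vertices_cases) (auto simp: corner.map_id)

lemma lift_lift_inverse:
  assumes f: "symmetry f" and v: "v \<in> vertices T"
  shows "lift f (lift (inv_into V f) v) = v" "lift (inv_into V f) (lift f v) = v"
proof -
  have "lift (f \<circ> inv_into V f) = lift id" "lift (inv_into V f \<circ> f) = lift id"
    using inv_symmetry[OF f] by (auto intro!: lift_cong)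
  with v lift_id show "lift f (lift (inv_into V f) v) = v" "lift (inv_into V f) (lift f v) = v"
    by (simp_all add: lift_compose[OF f symmetry_inverse[OF f]] lift_compose[OF symmetry_inverse[OF f] f])
qed

lemma image_eq_of_right_inverse:
  assumes "\<And>x. x \<in> A \<Longrightarrow> F x \<in> A" "\<And>x. x \<in> A \<Longrightarrow> G x \<in> A" "\<And>x. x \<in> A \<Longrightarrow> F (G x) = x"
  shows "F ` A = A"
  using assms by (metis (no_types, lifting) image_eqI image_subsetI subsetI subset_antisym)

lemma lift_automorphism:
  assumes f: "symmetry f"
  shows "lift f \<in> automorphisms T"
proof -
  note h = symmetry_inverse[OF f]
  let ?h = "lift (inv_into V f)"
  have ii: "lift f ` ?h ` e = e" if "e \<subseteq> vertices T" for e
    using that lift_lift_inverse(1)[OF f] by (force simp: image_image)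
  have "lift f \<in> Bij (vertices T)"
    unfolding Bij_def using lift_lift_inverse[OF f] lift_cells(1)[OF f] lift_cells(1)[OF h]
    by (auto simp: lift_def intro!: bij_betw_byWitness[where f' = ?h])
  moreover have "image (lift f) ` cedges T = cedges T"
    using lift_cells(4)[OF f] lift_cells(4)[OF h] ii cells_in_vertices
    by (intro image_eq_of_right_inverse[where G = "image ?h"]) auto
  moreover have "image (lift f) ` squares T = squares T"
    using lift_cells(5)[OF f] lift_cells(5)[OF h] ii cells_in_vertices
    by (intro image_eq_of_right_inverse[where G = "image ?h"]) auto
  moreover have "image (lift f) ` base_edges T = base_edges T"
    using lift_cells(3)[OF f] lift_cells(3)[OF h] ii cells_in_vertices
    by (intro image_eq_of_right_inverse[where G = "image ?h"]) auto
  moreover have "lift f ` base_vertices T = base_vertices T"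
    using lift_cells(2)[OF f] lift_cells(2)[OF h] lift_lift_inverse(1)[OF f]
    by (intro image_eq_of_right_inverse[where G = ?h]) (auto simp: vertices_def)
  ultimately show ?thesis by (simp add: automorphisms_def)
qed

subsection \<open>Automorphisms act on the tree by preserving turns\<close>

definition base_map :: "((nat, nat, nat) cvertex \<Rightarrow> (nat, nat, nat) cvertex) \<Rightarrow> nat \<Rightarrow> nat" where
  "base_map g v = (THE u. g (Base v) = Base u)"

context
  fixes g
  assumes g: "g \<in> automorphisms T"
begin

lemma automorphism_image:
  "v \<in> vertices T \<Longrightarrow> g v \<in> vertices T" "e \<in> cedges T \<Longrightarrow> g ` e \<in> cedges T"
  "inj_on g (vertices T)" "g ` Base ` V = Base ` V"
  using g unfolding automorphisms_def Bij_def by (auto simp: bij_betw_def base_vertices_T)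

lemma automorphism_Base:
  assumes "v \<in> V"
  shows "g (Base v) = Base (base_map g v)" "base_map g v \<in> V"
proof -
  obtain u where "g (Base v) = Base u" "u \<in> V"
    using automorphism_image(4) assms by blast
  moreover from this have "base_map g v = u" by (simp add: base_map_def)
  ultimately show "g (Base v) = Base (base_map g v)" "base_map g v \<in> V" by auto
qed

lemma base_map_inj: "u \<in> V \<Longrightarrow> v \<in> V \<Longrightarrow> base_map g u = base_map g v \<Longrightarrow> u = v"
  using automorphism_image(3) automorphism_Base(1)
  by (metis Base_in_vertices cvertex.inject(1) inj_onD)

text \<open>The edges with exactly one vertex in the tree join a vertex of a fin to the vertex of the tree
  below it, and automorphisms permute these edges.\<close>

lemma automorphism_Fin:
  assumes q: "q \<in> corners" "u \<in> verts (fin_graph q)"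
  shows "\<exists>q'\<in>corners. g (fin_vertex q u) = fin_vertex q' (base_map g u)"
proof -
  have u: "u \<in> V" using q fin_graph_subgraph(1) by blast
  have not_base: "g (fin_vertex q u) \<noteq> Base v" if "v \<in> V" for v
  proof
    assume eq: "g (fin_vertex q u) = Base v"
    have "Base v \<in> g ` Base ` V" using that automorphism_image(4) by simp
    then obtain z where z: "z \<in> V" "g (Base z) = Base v" by (metis imageE)
    have "fin_vertex q u = Base z"
      by (rule inj_onD[OF automorphism_image(3)]) (use eq q z in simp_all)
    then show False by simp
  qed
  have "g (fin_vertex q u) \<in> vertices T" using automorphism_image(1) q by simp
  then obtain q' u' where q': "q' \<in> corners" "u' \<in> verts (fin_graph q')" "g (fin_vertex q u) = fin_vertex q' u'"
    using not_base by (elim vertices_cases) auto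
  have "g ` {Base u, fin_vertex q u} \<in> cedges T"
    using automorphism_image(2) cedgesI(3)[OF q] by blast
  then have "{Base (base_map g u), fin_vertex q' u'} \<in> cedges T"
    using automorphism_Base[OF u] q' by simp
  then have "u' = base_map g u"
    by (cases rule: cedges_cases) (auto simp: doubleton_eq_iff)
  with q' show ?thesis by blast
qed

lemma automorphism_fin_edge:
  assumes q: "q \<in> corners" "{u, z} \<in> edges (fin_graph q)" and q': "q' \<in> corners"
    and u: "g (fin_vertex q u) = fin_vertex q' (base_map g u)"
  shows "g (fin_vertex q z) = fin_vertex q' (base_map g z)"
    "{base_map g u, base_map g z} \<in> edges (fin_graph q')"
proof -
  have uz: "u \<in> verts (fin_graph q)" "z \<in> verts (fin_graph q)"
    using fin_graph_subgraph(3)[OF q] by auto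
  obtain r where r: "r \<in> corners" "g (fin_vertex q z) = fin_vertex r (base_map g z)"
    using automorphism_Fin[OF q(1) uz(2)] by blast
  have "g ` fin_vertex q ` {u, z} \<in> cedges T"
    using automorphism_image(2) cedgesI(2)[OF q] by blast
  then have "{fin_vertex q' (base_map g u), fin_vertex r (base_map g z)} \<in> cedges T"
    using u r by simp
  then obtain s d where s: "s \<in> corners" "d \<in> edges (fin_graph s)"
    "{fin_vertex q' (base_map g u), fin_vertex r (base_map g z)} = fin_vertex s ` d"
    by (cases rule: cedges_cases) auto
  then have "fin_vertex q' (base_map g u) \<in> fin_vertex s ` d" "fin_vertex r (base_map g z) \<in> fin_vertex s ` d"
    by (metis insertI1, metis insertI1 insertI2)
  then have "q' = s" "r = s" by auto
  moreover have "d = {base_map g u, base_map g z}"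
  proof -
    have "fin_vertex s ` d = fin_vertex s ` {base_map g u, base_map g z}"
      using s(3) \<open>q' = s\<close> \<open>r = s\<close> by simp
    then show ?thesis by (subst (asm) inj_image_eq_iff) (auto simp: inj_def)
  qed
  ultimately
  show "g (fin_vertex q z) = fin_vertex q' (base_map g z)"
    "{base_map g u, base_map g z} \<in> edges (fin_graph q')"
    using s r by auto
qed

text \<open>A fin is connected, and so it is mapped into a single fin.\<close>

lemma automorphism_fin:
  assumes q: "Corner w y x t \<in> corners" and q': "q' \<in> corners"
    and u: "u \<in> verts (fin_graph (Corner w y x t))" "g (fin_vertex (Corner w y x t) u) = fin_vertex q' u'"
  shows "g (fin_vertex (Corner w y x t) w) = fin_vertex q' (base_map g w)"
proof -
  let ?q = "Corner w y x t"
  have "u' = base_map g u"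
    using automorphism_Fin[OF q u(1)] u(2) by auto
  with u have start: "g (fin_vertex ?q u) = fin_vertex q' (base_map g u)" by simp
  have "g (fin_vertex ?q z) = fin_vertex q' (base_map g z)"
    if "(\<lambda>a b. {a, b} \<in> edges (fin_graph ?q))\<^sup>*\<^sup>* u z" for z
    using that
  proof (induction rule: rtranclp_induct)
    case (step b c)
    then show ?case using automorphism_fin_edge(1)[OF q _ q'] by blast
  qed (rule start)
  then show ?thesis using fin_graph_connected[OF q u(1)] by blast
qed

lemma corner_centre:
  assumes q: "Corner w y x t \<in> corners"
    and e: "{p, a} \<in> edges (fin_graph (Corner w y x t))" "{p, b} \<in> edges (fin_graph (Corner w y x t))"
      "{p, c} \<in> edges (fin_graph (Corner w y x t))"
    and d: "a \<noteq> b" "b \<noteq> c" "a \<noteq> c"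
  shows "p = w"
proof (rule ccontr)
  assume p: "p \<noteq> w"
  have star: "z = w \<and> arc w p \<or> p = y \<and> z = x \<or> p = x \<and> (z = y \<or> z = t) \<or> p = t \<and> z = x"
    if "{p, z} \<in> edges (fin_graph (Corner w y x t))" for z
    using that p by (auto simp: doubleton_eq_iff)
  show False
    using star[OF e(1)] star[OF e(2)] star[OF e(3)] d p corner_distinct[OF q] by auto
qed

text \<open>The centre of the star is found by its degree, and then the rest of the corner is found
  along the path that leaves the star.\<close>

lemma automorphism_corner:
  assumes q: "Corner w y x t \<in> corners" and q': "Corner w' y' x' t' \<in> corners"
    and u: "u \<in> verts (fin_graph (Corner w y x t))"
      "g (fin_vertex (Corner w y x t) u) = fin_vertex (Corner w' y' x' t') u'"
  shows "base_map g w = w'" "base_map g y = y'" "base_map g x = x'" "base_map g t = t'"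
proof -
  let ?q = "Corner w y x t" and ?q' = "Corner w' y' x' t'"
  have wy: "arc w y" and turn: "turn x y t" "turn x' y' t'"
    using q q' by (auto simp: corners_def)
  have w: "g (fin_vertex ?q w) = fin_vertex ?q' (base_map g w)"
    by (rule automorphism_fin[OF q q' u])
  have e: "{w, z} \<in> edges (fin_graph ?q)" if "arc w z" for z using that by auto
  note star = automorphism_fin_edge[OF q e q' w]
  have yx: "{y, x} \<in> edges (fin_graph ?q)" and xt: "{x, t} \<in> edges (fin_graph ?q)" by simp_all
  note yx' = automorphism_fin_edge[OF q yx q' star(1)[OF wy]]
  note xt' = automorphism_fin_edge(2)[OF q xt q' yx'(1)]
  obtain b where b: "turn w y b" using wy ex_turn by blast
  then obtain c where c: "turn w b c" using turn_arc ex_turn by blast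
  have arcs: "arc w y" "arc w b" "arc w c" using b c turn_arc by blast+
  have distinct: "y \<noteq> b" "b \<noteq> c" "y \<noteq> c"
    using turn_neq b c turn_cycle[OF b c] by blast+
  have V: "w \<in> V" "y \<in> V" "x \<in> V" "t \<in> V" "b \<in> V" "c \<in> V"
    using arcs turn turn_arc arc_in_V by blast+
  note inj = base_map_inj
  show w': "base_map g w = w'"
    using corner_centre[OF q' star(2)[OF arcs(1)] star(2)[OF arcs(2)] star(2)[OF arcs(3)]]
      inj distinct V by blast
  note d = corner_distinct[OF q] corner_distinct[OF q']
  have y_out: "arc w' (base_map g y)"
    using star(2)[OF wy] w' d by (auto simp: doubleton_eq_iff)
  have x_neq: "base_map g x \<noteq> w'" using inj[OF V(3) V(1)] w' d(5) by metis
  have "base_map g y = y' \<and> base_map g x = x'"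
    using yx'(2) y_out x_neq d arc_neq[OF y_out] by (auto simp: doubleton_eq_iff)
  then show y': "base_map g y = y'" and x': "base_map g x = x'" by auto
  have "base_map g t \<noteq> y'" using inj[OF V(4) V(2)] y' d(3) by metis
  then show "base_map g t = t'"
    using xt' x' d by (auto simp: doubleton_eq_iff)
qed

lemma automorphism_turn:
  assumes "turn x y t"
  shows "turn (base_map g x) (base_map g y) (base_map g t)"
proof -
  obtain w where w: "arc w y" "w \<noteq> x" using ex_other_arc turn_arc assms by blast
  then have q: "Corner w y x t \<in> corners" using assms by (auto simp: corners_def)
  obtain q' where q': "q' \<in> corners" "g (fin_vertex (Corner w y x t) w) = fin_vertex q' (base_map g w)"
    using automorphism_Fin[OF q, of w] by auto
  obtain w' y' x' t' where c: "q' = Corner w' y' x' t'" "turn x' y' t'"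
    using q' by (auto simp: corners_def)
  then show ?thesis
    using automorphism_corner[OF q q'(1)[unfolded c(1)] _ q'(2)[unfolded c(1)]] by simp
qed

lemma automorphism_arc: "arc x y \<Longrightarrow> arc (base_map g x) (base_map g y)"
  using automorphism_turn ex_turn turn_arc(1) by blast

text \<open>The only orders of an element of the cyclic group of order three are one and three.\<close>

lemma automorphism_cube_fixes:
  assumes "base_map g v = v" "arc v c"
  shows "base_map g (base_map g (base_map g c)) = c"
proof -
  let ?b = "base_map g"
  obtain d where d: "turn v c d" using assms ex_turn by blast
  then obtain e where e: "turn v d e" using turn_arc ex_turn by blast
  have 3: "turn v e c" by (rule turn_cycle[OF d e])
  have t: "turn v (?b x) (?b y)" if "turn v x y" for x y
    using automorphism_turn[OF that] assms by simp
  have "?b c = c \<or> ?b c = d \<or> ?b c = e"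
    using out_neighbours[OF d e] automorphism_arc[OF assms(2)] assms(1) by simp
  then show ?thesis
    using t[OF d] t[OF e] t[OF 3] d e 3 turn_unique by metis
qed

end

section \<open>Locally full subgroups have infinite vertex stabilisers\<close>

lemma carrier_Aut: "carrier (Aut T) = automorphisms T"
  by (simp add: Aut_def)

lemma mult_Aut:
  "g \<in> automorphisms T \<Longrightarrow> h \<in> automorphisms T \<Longrightarrow> g \<otimes>\<^bsub>Aut T\<^esub> h = compose (vertices T) g h"
  by (simp add: Aut_def BijGroup_def automorphisms_def)

lemma base_map_compose:
  assumes "g \<in> automorphisms T" "h \<in> automorphisms T" "v \<in> V"
  shows "base_map (compose (vertices T) g h) v = base_map g (base_map h v)"
proof -
  have "compose (vertices T) g h (Base v) = Base (base_map g (base_map h v))"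
    using assms automorphism_Base by (simp add: compose_eq)
  then show ?thesis by (simp add: base_map_def[of "compose (vertices T) g h"])
qed

lemma subgroup_base_map_compose:
  assumes "subgroup \<Gamma> (Aut T)" "g \<in> \<Gamma>" "h \<in> \<Gamma>"
  shows "\<exists>k\<in>\<Gamma>. \<forall>v\<in>V. base_map k v = base_map g (base_map h v)"
proof -
  have "g \<in> automorphisms T" "h \<in> automorphisms T"
    using assms subgroup.subset carrier_Aut by blast+
  then show ?thesis
    using subgroup.m_closed[OF assms] base_map_compose by (auto simp: mult_Aut)
qed

definition fixes_all :: "((nat, nat, nat) cvertex \<Rightarrow> (nat, nat, nat) cvertex) \<Rightarrow> nat set \<Rightarrow> bool" where
  "fixes_all g A \<longleftrightarrow> (\<forall>u\<in>A. base_map g u = u)"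

text \<open>The vertex stabilisers in the full automorphism group act on the three in-neighbours as the
  symmetric group and on the three out-neighbours as the cyclic group.  Transpositions generate the
  former, and a transitive subgroup of the latter is everything.\<close>

definition locally_full :: "((nat, nat, nat) cvertex \<Rightarrow> (nat, nat, nat) cvertex) set \<Rightarrow> bool" where
  "locally_full \<Gamma> \<longleftrightarrow>
     (\<forall>v a b. arc a v \<longrightarrow> arc b v \<longrightarrow> a \<noteq> b \<longrightarrow>
        (\<exists>g\<in>\<Gamma>. base_map g v = v \<and> base_map g a = b \<and> base_map g b = a)) \<and>
     (\<forall>v c d. arc v c \<longrightarrow> arc v d \<longrightarrow> (\<exists>g\<in>\<Gamma>. base_map g v = v \<and> base_map g c = d))"

text \<open>The symmetric group of degree three and the cyclic group of order three have no common
  quotient apart from the trivial group.  So a group that maps onto both maps onto their product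
  (Goursat), and the stabiliser of a directed path keeps its full action at both ends when the path
  grows.  Concretely, the cube of an element that acts at the start as a transposition acts there as the
  same transposition, but it acts trivially on the out-neighbours of the end.  Hence the path can be
  prolonged at its end without losing the transpositions at its start, and these transpositions serve
  to correct an element that rotates the out-neighbours of the end but moves a new first vertex.\<close>

lemma path_stabilizer_locally_full:
  assumes \<Gamma>: "subgroup \<Gamma> (Aut T)" and full: "locally_full \<Gamma>"
    and p: "successively arc p" "p \<noteq> []" "set p \<subseteq> V"
  shows "arc a (hd p) \<Longrightarrow> arc b (hd p) \<Longrightarrow> a \<noteq> b \<Longrightarrow>
      \<exists>g\<in>\<Gamma>. fixes_all g (set p) \<and> base_map g a = b \<and> base_map g b = a"
    and "arc (last p) c \<Longrightarrow> arc (last p) d \<Longrightarrow>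
      \<exists>g\<in>\<Gamma>. fixes_all g (set p) \<and> base_map g c = d"
proof -
  have aut: "g \<in> automorphisms T" if "g \<in> \<Gamma>" for g
    using that \<Gamma> subgroup.subset carrier_Aut by blast
  let ?swaps = "\<lambda>p. \<forall>a b. arc a (hd p) \<longrightarrow> arc b (hd p) \<longrightarrow> a \<noteq> b \<longrightarrow>
      (\<exists>g\<in>\<Gamma>. fixes_all g (set p) \<and> base_map g a = b \<and> base_map g b = a)"
  let ?rotates = "\<lambda>p. \<forall>c d. arc (last p) c \<longrightarrow> arc (last p) d \<longrightarrow>
      (\<exists>g\<in>\<Gamma>. fixes_all g (set p) \<and> base_map g c = d)"
  have main: "\<forall>p. length p = Suc n \<longrightarrow> successively arc p \<longrightarrow> set p \<subseteq> V \<longrightarrow> ?swaps p \<and> ?rotates p" for n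
  proof (induction n)
    case 0
    have "?swaps [v]" "?rotates [v]" for v
      using full unfolding locally_full_def fixes_all_def by auto
    then show ?case by (auto simp: length_Suc_conv)
  next
    case (Suc n)
    have swaps: "?swaps p" if p: "length p = Suc (Suc n)" "successively arc p" "set p \<subseteq> V" for p
    proof (intro allI impI)
      fix a b assume ab: "arc a (hd p)" "arc b (hd p)" "a \<noteq> b"
      obtain q c where qc: "p = q @ [c]"
        using p(1) by (cases p rule: rev_cases) simp_all
      with p(1) have q: "p = q @ [c]" "q \<noteq> []" by auto
      have c: "arc (last q) c" "successively arc q" "set q \<subseteq> V" "length q = Suc n"
        using p q by (auto simp: successively_append_iff)
      with Suc.IH have "?swaps q" by blast
      with ab q obtain h where h: "h \<in> \<Gamma>" "fixes_all h (set q)" "base_map h a = b" "base_map h b = a"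
        by auto
      \<comment> \<open>The cube of \<open>h\<close> is formed in two steps.\<close>
      obtain h2 where h2: "h2 \<in> \<Gamma>" "\<forall>v\<in>V. base_map h2 v = base_map h (base_map h v)"
        using subgroup_base_map_compose[OF \<Gamma> h(1) h(1)] by blast
      obtain h3 where h3: "h3 \<in> \<Gamma>" "\<forall>v\<in>V. base_map h3 v = base_map h (base_map h2 v)"
        using subgroup_base_map_compose[OF \<Gamma> h(1) h2(1)] by blast
      have cube: "base_map h3 v = base_map h (base_map h (base_map h v))" if "v \<in> V" for v
        using that h2 h3 by simp
      have "base_map h (last q) = last q"
        using h(2) q(2) by (simp add: fixes_all_def)
      then have "base_map h3 c = c"
        using automorphism_cube_fixes[OF aut[OF h(1)] _ c(1)] cube arc_in_V(2)[OF c(1)] by simp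
      moreover have "base_map h3 u = u" if "u \<in> set q" for u
        using that h(2) c(3) cube by (auto simp: fixes_all_def subset_iff)
      ultimately have "fixes_all h3 (set p)" by (auto simp: fixes_all_def q)
      moreover have "base_map h3 a = b" "base_map h3 b = a"
        using cube h ab arc_in_V(1) by auto
      ultimately show "\<exists>g\<in>\<Gamma>. fixes_all g (set p) \<and> base_map g a = b \<and> base_map g b = a"
        using h3(1) by blast
    qed
    have rotates: "?rotates p" if p: "length p = Suc (Suc n)" "successively arc p" "set p \<subseteq> V" for p
    proof (intro allI impI)
      fix c d assume cd: "arc (last p) c" "arc (last p) d"
      obtain z q where zq: "p = z # q"
        using p(1) by (cases p) simp_all
      with p(1) have q: "p = z # q" "q \<noteq> []" by auto
      have z: "arc z (hd q)" "successively arc q" "set q \<subseteq> V" "length q = Suc n"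
        using p q by (auto simp: successively_Cons)
      with Suc.IH have "?rotates q" by blast
      with cd q obtain h where h: "h \<in> \<Gamma>" "fixes_all h (set q)" "base_map h c = d"
        by auto
      have hd: "base_map h (hd q) = hd q" using h(2) q(2) by (simp add: fixes_all_def)
      show "\<exists>g\<in>\<Gamma>. fixes_all g (set p) \<and> base_map g c = d"
      proof (cases "base_map h z = z")
        case True
        with h q show ?thesis by (auto simp: fixes_all_def)
      next
        case False
        \<comment> \<open>An element that fixes \<open>q\<close> and \<open>d\<close> and brings the image of \<open>z\<close> back repairs \<open>h\<close>.\<close>
        have z': "arc (base_map h z) (hd q)"
          using automorphism_arc[OF aut[OF h(1)] z(1)] hd by simp
        have "?swaps (q @ [d])"
          using z cd q arc_in_V(2) by (intro swaps) (auto simp: successively_append_iff)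
        then obtain k where k: "k \<in> \<Gamma>" "fixes_all k (set (q @ [d]))" "base_map k (base_map h z) = z"
          using z' z(1) False q(2) by (auto simp: hd_append)
        obtain g where g: "g \<in> \<Gamma>" "\<forall>v\<in>V. base_map g v = base_map k (base_map h v)"
          using subgroup_base_map_compose[OF \<Gamma> k(1) h(1)] by blast
        have "fixes_all g (set p)"
          using g(2) k h(2) p(3) q(1) by (auto simp: fixes_all_def)
        moreover have "base_map g c = d"
          using g(2) k(2) h(3) arc_in_V(2)[OF cd(1)] by (simp add: fixes_all_def)
        ultimately show ?thesis using g(1) by blast
      qed
    qed
    show ?case using swaps rotates by blast
  qed
  have "?swaps p \<and> ?rotates p"
    using main[of "length p - 1"] p by auto
  then show "arc a (hd p) \<Longrightarrow> arc b (hd p) \<Longrightarrow> a \<noteq> b \<Longrightarrow>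
      \<exists>g\<in>\<Gamma>. fixes_all g (set p) \<and> base_map g a = b \<and> base_map g b = a"
    "arc (last p) c \<Longrightarrow> arc (last p) d \<Longrightarrow> \<exists>g\<in>\<Gamma>. fixes_all g (set p) \<and> base_map g c = d"
    by blast+
qed

primrec ray :: "nat \<Rightarrow> nat" where
  "ray 0 = origin"
| "ray (Suc n) = act (Out 0) (ray n)"

lemma ray_in_V: "ray n \<in> V"
  by (induction n) (auto simp: origin_in_V act_in_V)

lemma arc_ray: "arc (ray n) (ray (Suc n))"
  using ray_in_V by (auto simp: arc_def)

text \<open>Along a directed ray the pointwise stabilisers of the initial segments form a strictly
  decreasing sequence of subgroups.\<close>

lemma locally_full_infinite_stabilizer:
  assumes \<Gamma>: "subgroup \<Gamma> (Aut T)" and full: "locally_full \<Gamma>"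
  shows "infinite {g \<in> \<Gamma>. base_map g origin = origin}"
proof
  define S where "S n = {g \<in> \<Gamma>. \<forall>i\<le>n. base_map g (ray i) = ray i}" for n
  assume "finite {g \<in> \<Gamma>. base_map g origin = origin}"
  then have fin: "finite (S 0)" by (simp add: S_def)
  have sub: "S n \<subseteq> S 0" for n by (auto simp: S_def)
  have "S (Suc n) \<subset> S n" for n
  proof -
    let ?p = "map ray [0..<Suc n]"
    obtain d where d: "turn (ray n) (ray (Suc n)) d" using ex_turn arc_ray by blast
    have path: "successively arc ?p" using arc_ray by (simp add: successively_conv_nth del: upt_Suc ray.simps)
    have p: "?p \<noteq> []" "set ?p \<subseteq> V" using ray_in_V by auto
    have "arc (last ?p) (ray (Suc n))" "arc (last ?p) d"
      using arc_ray[of n] turn_arc(2)[OF d] by simp_all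
    then obtain g where g: "g \<in> \<Gamma>" "fixes_all g (set ?p)" "base_map g (ray (Suc n)) = d"
      using path_stabilizer_locally_full(2)[OF \<Gamma> full path p] by blast
    then have "g \<in> S n" by (auto simp: S_def fixes_all_def simp del: upt_Suc)
    moreover have "g \<notin> S (Suc n)" using g(3) turn_neq[OF d] by (auto simp: S_def)
    moreover have "S (Suc n) \<subseteq> S n" by (auto simp: S_def)
    ultimately show ?thesis by blast
  qed
  then have less: "card (S (Suc n)) < card (S n)" for n
    using sub fin by (metis finite_subset psubset_card_mono)
  have "card (S n) + n \<le> card (S 0)" for n
  proof (induction n)
    case (Suc n)
    with less[of n] show ?case by simp
  qed simp
  from this[of "Suc (card (S 0))"] show False by simp
qed

section \<open>The two properties force local fullness\<close>

subsection \<open>The group of automorphisms\<close>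

lemma automorphisms_subgroup: "subgroup (automorphisms T) (BijGroup (vertices T))"
proof (rule group.subgroupI[OF group_BijGroup])
  show "automorphisms T \<subseteq> carrier (BijGroup (vertices T))"
    by (auto simp: automorphisms_def BijGroup_def)
  show "automorphisms T \<noteq> {}"
    using lift_automorphism translation_symmetry translation_id by blast
next
  fix g assume g: "g \<in> automorphisms T"
  let ?S = "vertices T"
  define k where "k = restrict (inv_into ?S g) ?S"
  have gB: "g \<in> Bij ?S" using g by (simp add: automorphisms_def)
  then have inj: "inj_on g ?S" by (simp add: Bij_def bij_betw_def)
  have kg: "k (g v) = v" if "v \<in> ?S" for v
    using that inj automorphism_image(1)[OF g that] by (simp add: k_def)
  have undo: "k ` g ` e = e" if "e \<subseteq> ?S" for e
    unfolding image_image by (subst image_cong[of e e _ id]) (use that kg in auto)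
  have inverse_image: "image k ` C = C" if "\<And>e. e \<in> C \<Longrightarrow> e \<subseteq> ?S" "image g ` C = C" for C
  proof -
    have "image k ` C = image k ` image g ` C" using that(2) by simp
    also have "\<dots> = C" unfolding image_image using undo[unfolded image_image] that(1) by simp
    finally show ?thesis .
  qed
  have "k ` base_vertices T = base_vertices T"
  proof -
    have "base_vertices T \<subseteq> ?S" by (simp add: vertices_def)
    from undo[OF this] show ?thesis using g by (simp add: automorphisms_def)
  qed
  moreover have "k \<in> Bij ?S" unfolding k_def by (rule restrict_inv_into_Bij[OF gB])
  ultimately have "k \<in> automorphisms T"
    using g inverse_image cells_in_vertices by (auto simp: automorphisms_def)
  then show "inv\<^bsub>BijGroup ?S\<^esub> g \<in> automorphisms T"
    by (simp add: inv_BijGroup[OF gB] k_def)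
next
  fix g h assume g: "g \<in> automorphisms T" and h: "h \<in> automorphisms T"
  let ?S = "vertices T"
  have B: "g \<in> Bij ?S" "h \<in> Bij ?S" using g h by (simp_all add: automorphisms_def)
  have image: "compose ?S g h ` e = g ` h ` e" if "e \<subseteq> ?S" for e
    using that unfolding image_image by (intro image_cong) (auto simp: compose_eq)
  have images: "image (compose ?S g h) ` C = C"
    if "\<And>e. e \<in> C \<Longrightarrow> e \<subseteq> ?S" "image g ` C = C" "image h ` C = C" for C
  proof -
    have "image (compose ?S g h) ` C = (\<lambda>e. g ` h ` e) ` C"
      by (intro image_cong refl image that(1))
    also have "\<dots> = image g ` image h ` C" by auto
    also have "\<dots> = C" using that by simp
    finally show ?thesis .
  qed
  have "compose ?S g h ` base_vertices T = base_vertices T"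
  proof -
    have "base_vertices T \<subseteq> ?S" by (simp add: vertices_def)
    from image[OF this] show ?thesis using g h by (simp add: automorphisms_def)
  qed
  then have "compose ?S g h \<in> automorphisms T"
    using g h images cells_in_vertices compose_Bij[OF B] by (auto simp: automorphisms_def)
  then show "g \<otimes>\<^bsub>BijGroup ?S\<^esub> h \<in> automorphisms T"
    using B by (simp add: BijGroup_def)
qed

lemma group_Aut: "group (Aut T)"
  unfolding Aut_def by (rule subgroup.subgroup_is_group[OF automorphisms_subgroup group_BijGroup])

lemma one_Aut: "\<one>\<^bsub>Aut T\<^esub> = (\<lambda>v\<in>vertices T. v)"
  by (simp add: Aut_def BijGroup_def)

lemma automorphism_compose:
  assumes "g \<in> automorphisms T" "h \<in> automorphisms T"
  shows "\<exists>k\<in>automorphisms T. \<forall>v\<in>vertices T. k v = g (h v)"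
proof -
  have "g \<otimes>\<^bsub>Aut T\<^esub> h \<in> automorphisms T"
    using monoid.m_closed[OF group.is_monoid[OF group_Aut]] assms by (simp add: carrier_Aut)
  then show ?thesis using assms by (intro bexI) (auto simp: mult_Aut compose_eq)
qed

lemma automorphism_inverse:
  assumes "g \<in> automorphisms T"
  shows "\<exists>k\<in>automorphisms T. \<forall>v\<in>vertices T. k (g v) = v"
proof -
  let ?k = "inv\<^bsub>Aut T\<^esub> g"
  have k: "?k \<in> automorphisms T"
    using group.inv_closed[OF group_Aut] assms by (simp add: carrier_Aut)
  have "compose (vertices T) ?k g = \<one>\<^bsub>Aut T\<^esub>"
    using group.l_inv[OF group_Aut, of g] assms k by (simp add: carrier_Aut mult_Aut)
  then have "?k (g v) = v" if "v \<in> vertices T" for v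
    using that fun_cong[of _ _ v] compose_eq[OF that, of ?k g] by (metis one_Aut restrict_apply')
  with k show ?thesis by blast
qed

lemma base_map_lift: "symmetry f \<Longrightarrow> v \<in> V \<Longrightarrow> base_map (lift f) v = f v"
  by (simp add: base_map_def)

subsection \<open>Points at the vertices\<close>

definition vertex_point :: "'a \<Rightarrow> 'a \<Rightarrow> real" where
  "vertex_point v = (\<lambda>z. if z = v then 1 else 0)"

lemma vertex_point_eq_iff: "vertex_point u = vertex_point v \<longleftrightarrow> u = v"
  by (auto simp: vertex_point_def fun_eq_iff split: if_splits)

lemma push_vertex_point: "push g (vertex_point v) = vertex_point (g v)"
proof
  fix z
  have "{u. vertex_point v u \<noteq> 0 \<and> g u = z} = (if g v = z then {v} else {})"
    by (auto simp: vertex_point_def)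
  then show "push g (vertex_point v) z = vertex_point (g v) z"
    by (simp add: push_def vertex_point_def)
qed

lemma vertex_point_in_graph: "v \<in> verts G \<Longrightarrow> vertex_point v \<in> graph_points G"
proof -
  have "{u. vertex_point v u \<noteq> 0} = {v}" by (auto simp: vertex_point_def)
  moreover assume "v \<in> verts G"
  ultimately show ?thesis by (simp add: graph_points_def vertex_point_def)
qed

lemma vertex_point_in_realization:
  assumes "v \<in> vertices T"
  shows "vertex_point v \<in> realization T"
  using assms
proof (cases rule: vertices_cases)
  case (1 u)
  then have "vertex_point u \<in> graph_points (base_tree T)" by (simp add: vertex_point_in_graph)
  then have "push Base (vertex_point u) \<in> realization T"
    unfolding realization_def by (intro UnI1 imageI)
  then show ?thesis using 1 by (simp add: push_vertex_point)
next
  case (2 q u)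
  have "vertex_point u \<in> graph_points (fin_tree T (to_nat q))"
    using 2 by (simp add: vertex_point_in_graph)
  moreover have "vertex_point v = cylinder_point T (to_nat q) (vertex_point u) 1"
    using 2 by (simp add: cylinder_point_def push_vertex_point)
  moreover have "to_nat q \<in> fin_index T" using 2 by simp
  ultimately show ?thesis
    unfolding realization_def
    by (intro UnI2 CollectI exI[of _ "to_nat q"] exI[of _ "vertex_point u"] exI[of _ 1]) simp
qed

lemma proper_finite_stabilizer:
  assumes "acts_properly T \<Gamma>" "v \<in> V"
  shows "finite {g \<in> \<Gamma>. g (Base v) = Base v}"
proof -
  let ?K = "{vertex_point (Base v :: (nat, nat, nat) cvertex)}"
  have "?K \<subseteq> realization T" "compact ?K"
    using vertex_point_in_realization[of "Base v"] assms(2) by auto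
  then have "finite {g \<in> \<Gamma>. push g ` ?K \<inter> ?K \<noteq> {}}"
    using assms(1) unfolding acts_properly_def by blast
  then show ?thesis by (simp add: push_vertex_point vertex_point_eq_iff eq_commute)
qed

lemma locally_full_not_proper:
  assumes "subgroup \<Gamma> (Aut T)" "locally_full \<Gamma>"
  shows "\<not> acts_properly T \<Gamma>"
proof
  assume p: "acts_properly T \<Gamma>"
  have aut: "g \<in> automorphisms T" if "g \<in> \<Gamma>" for g
    using that assms(1) subgroup.subset carrier_Aut by blast
  have "base_map g origin = origin \<longleftrightarrow> g (Base origin) = Base origin" if "g \<in> \<Gamma>" for g
    using automorphism_Base(1)[OF aut[OF that] origin_in_V] by simp
  then have "{g \<in> \<Gamma>. base_map g origin = origin} = {g \<in> \<Gamma>. g (Base origin) = Base origin}"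
    by (intro Collect_cong) auto
  then show False
    using locally_full_infinite_stabilizer[OF assms] proper_finite_stabilizer[OF p origin_in_V] by simp
qed

subsection \<open>Induced permutations and orbits\<close>

lemma same_permutations_locally_full:
  assumes \<Gamma>: "subgroup \<Gamma> (Aut T)"
    and perm: "\<And>x. x \<in> V \<Longrightarrow> induced_permutations T (automorphisms T) x \<subseteq> induced_permutations T \<Gamma> x"
  shows "locally_full \<Gamma>"
proof -
  have agree: "\<exists>g\<in>\<Gamma>. base_map g v = v \<and> (\<forall>u. arc v u \<or> arc u v \<longrightarrow> base_map g u = f u)"
    if f: "symmetry f" "f v = v" and v: "v \<in> V" for f v
  proof -
    have "lift f \<in> stabilizer (Aut_sub T (automorphisms T)) (\<lambda>g. g) (Base v)"
      using lift_automorphism f v by (simp add: stabilizer_def)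
    then have "restrict (image (lift f)) (incident_edges T v) \<in> induced_permutations T \<Gamma> v"
      using perm[OF v] unfolding induced_permutations_def by blast
    then obtain g where g: "g \<in> \<Gamma>" "g (Base v) = Base v"
      "restrict (image (lift f)) (incident_edges T v) = restrict (image g) (incident_edges T v)"
      unfolding induced_permutations_def stabilizer_def by auto
    have aut: "g \<in> automorphisms T" using g(1) \<Gamma> subgroup.subset carrier_Aut by blast
    have "base_map g u = f u" if u: "arc v u \<or> arc u v" for u
    proof -
      have "u \<in> V" using u arc_in_V by blast
      have "{v, u} \<in> edges X" using u adjacent_iff_arc by simp
      then have "Base ` {v, u} \<in> incident_edges T v"
        unfolding incident_edges_def using base_edgesI[of "{v, u}"] by simp
      then have "lift f ` Base ` {v, u} = g ` Base ` {v, u}"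
        using g(3) by (metis restrict_apply')
      then have "{Base v, Base (f u)} = {Base v, Base (base_map g u) :: (nat, nat, nat) cvertex}"
        using g(2) f v \<open>u \<in> V\<close> automorphism_Base(1)[OF aut] by simp
      then show ?thesis by (auto simp: doubleton_eq_iff)
    qed
    moreover have "base_map g v = v" using g(2) by (simp add: base_map_def)
    ultimately show ?thesis using g(1) by blast
  qed
  show ?thesis
    unfolding locally_full_def
  proof (intro conjI allI impI)
    fix v a b assume ab: "arc a v" "arc b v" "a \<noteq> b"
    obtain f where "symmetry f" "f v = v" "f a = b" "f b = a" using ex_symmetry_swap[OF ab] by blast
    with agree[of f v] ab arc_in_V(2) show "\<exists>g\<in>\<Gamma>. base_map g v = v \<and> base_map g a = b \<and> base_map g b = a"
      by metis
  next
    fix v c d assume cd: "arc v c" "arc v d"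
    obtain f where "symmetry f" "f v = v" "f c = d" using ex_symmetry_rotation[OF cd] by blast
    with agree[of f v] cd arc_in_V(1) show "\<exists>g\<in>\<Gamma>. base_map g v = v \<and> base_map g c = d"
      by metis
  qed
qed

text \<open>Injectivity of the natural map, applied to the points at the vertices, says that the subgroup
  has the same orbits of vertices as the whole group.\<close>

lemma natural_map_iso_vertex_orbits:
  assumes \<Gamma>: "subgroup \<Gamma> (Aut T)" and iso: "natural_map_iso T \<Gamma>"
    and v: "v \<in> vertices T" and g: "g \<in> automorphisms T"
  shows "\<exists>h\<in>\<Gamma>. h v = g v"
proof -
  have aut: "h \<in> automorphisms T" if "h \<in> \<Gamma>" for h
    using that \<Gamma> subgroup.subset carrier_Aut by blast
  obtain e where e: "e \<in> \<Gamma>" "\<And>u. u \<in> vertices T \<Longrightarrow> e u = u"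
    using subgroup.one_closed[OF \<Gamma>] by (auto simp: Aut_def BijGroup_def)
  let ?o = "\<lambda>u. orbit (Aut_sub T \<Gamma>) push (vertex_point u)"
  have o: "?o u = {vertex_point (h u) | h. h \<in> \<Gamma>}" for u
    by (simp add: orbit_def push_vertex_point)
  have nat: "natural_map T (?o u) = {vertex_point (k u) | k. k \<in> automorphisms T}"
    if u: "u \<in> vertices T" for u
  proof
    show "natural_map T (?o u) \<subseteq> {vertex_point (k u) | k. k \<in> automorphisms T}"
    proof
      fix p assume "p \<in> natural_map T (?o u)"
      then obtain h k where "h \<in> \<Gamma>" "k \<in> automorphisms T" "p = vertex_point (k (h u))"
        unfolding natural_map_def o by (auto simp: orbit_def push_vertex_point carrier_Aut)
      then show "p \<in> {vertex_point (k u) | k. k \<in> automorphisms T}"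
        using automorphism_compose[OF _ aut] u by (metis (mono_tags, lifting) mem_Collect_eq)
    qed
    show "{vertex_point (k u) | k. k \<in> automorphisms T} \<subseteq> natural_map T (?o u)"
    proof
      fix p assume "p \<in> {vertex_point (k u) | k. k \<in> automorphisms T}"
      then obtain k where k: "k \<in> automorphisms T" "p = vertex_point (k u)" by blast
      have "vertex_point u \<in> ?o u" unfolding o using e u by (intro CollectI exI[of _ e]) simp
      moreover have "p \<in> orbit (Aut T) push (vertex_point u)"
        using k by (auto simp: orbit_def push_vertex_point carrier_Aut)
      ultimately show "p \<in> natural_map T (?o u)" unfolding natural_map_def by blast
    qed
  qed
  have gv: "g v \<in> vertices T" using automorphism_image(1)[OF g v] .
  obtain g' where g': "g' \<in> automorphisms T" "\<And>u. u \<in> vertices T \<Longrightarrow> g' (g u) = u"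
    using automorphism_inverse[OF g] by blast
  have "{vertex_point (k v) | k. k \<in> automorphisms T} = {vertex_point (k (g v)) | k. k \<in> automorphisms T}"
    (is "?L = ?R")
  proof
    show "?L \<subseteq> ?R"
    proof
      fix p assume "p \<in> ?L"
      then obtain k where k: "k \<in> automorphisms T" "p = vertex_point (k v)" by blast
      obtain l where "l \<in> automorphisms T" "\<And>u. u \<in> vertices T \<Longrightarrow> l u = k (g' u)"
        using automorphism_compose[OF k(1) g'(1)] by blast
      then show "p \<in> ?R" using k g'(2) v gv by (intro CollectI exI[of _ l]) simp
    qed
    show "?R \<subseteq> ?L"
    proof
      fix p assume "p \<in> ?R"
      then obtain k where k: "k \<in> automorphisms T" "p = vertex_point (k (g v))" by blast
      obtain l where "l \<in> automorphisms T" "\<And>u. u \<in> vertices T \<Longrightarrow> l u = k (g u)"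
        using automorphism_compose[OF k(1) g] by blast
      then show "p \<in> ?L" using k v by (intro CollectI exI[of _ l]) simp
    qed
  qed
  then have "natural_map T (?o v) = natural_map T (?o (g v))" using nat v gv by simp
  moreover have "?o u \<in> quotient T \<Gamma>" if "u \<in> vertices T" for u
    unfolding quotient_def orbits_def using vertex_point_in_realization[OF that] by blast
  ultimately have "?o v = ?o (g v)"
    using iso v gv unfolding natural_map_iso_def bij_betw_def inj_on_def by blast
  moreover have "vertex_point (g v) \<in> ?o (g v)" unfolding o using e gv by (intro CollectI exI[of _ e]) simp
  ultimately have "vertex_point (g v) \<in> {vertex_point (h v) | h. h \<in> \<Gamma>}" unfolding o by simp
  then show ?thesis by (auto simp: vertex_point_eq_iff)
qed

text \<open>Elements that agree at one vertex of a fin agree on its whole corner \<open>(w, y, x, t)\<close>.  A swap of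
  \<open>w\<close> and \<open>x\<close> that fixes \<open>y\<close>, or an element that fixes \<open>w\<close> and moves \<open>y\<close>, is therefore detected by the
  orbits of fin vertices.\<close>

lemma natural_map_iso_locally_full:
  assumes \<Gamma>: "subgroup \<Gamma> (Aut T)" and iso: "natural_map_iso T \<Gamma>"
  shows "locally_full \<Gamma>"
proof -
  have agree: "\<exists>g\<in>\<Gamma>. base_map g w = f w \<and> base_map g y = f y \<and> base_map g x = f x"
    if f: "symmetry f" and q: "Corner w y x t \<in> corners" for f w y x t
  proof -
    let ?q = "Corner w y x t"
    have w: "w \<in> verts (fin_graph ?q)" by simp
    obtain g where g: "g \<in> \<Gamma>" "g (fin_vertex ?q w) = lift f (fin_vertex ?q w)"
      using natural_map_iso_vertex_orbits[OF \<Gamma> iso _ lift_automorphism[OF f], of "fin_vertex ?q w"] q w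
      by auto
    have aut: "g \<in> automorphisms T" using g(1) \<Gamma> subgroup.subset carrier_Aut by blast
    have q': "Corner (f w) (f y) (f x) (f t) \<in> corners"
      using symmetry_corner(1)[OF f q] by simp
    have "g (fin_vertex ?q w) = fin_vertex (Corner (f w) (f y) (f x) (f t)) (f w)"
      using g(2) q w by simp
    from automorphism_corner[OF aut q q' w this] g(1) show ?thesis by blast
  qed
  show ?thesis
    unfolding locally_full_def
  proof (intro conjI allI impI)
    fix v a b assume ab: "arc a v" "arc b v" "a \<noteq> b"
    obtain f where f: "symmetry f" "f v = v" "f a = b" "f b = a" using ex_symmetry_swap[OF ab] by blast
    obtain t where "turn b v t" using ab(2) ex_turn by blast
    then have "Corner a v b t \<in> corners" using ab by (auto simp: corners_def)
    from agree[OF f(1) this] f show "\<exists>g\<in>\<Gamma>. base_map g v = v \<and> base_map g a = b \<and> base_map g b = a"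
      by auto
  next
    fix v c d assume cd: "arc v c" "arc v d"
    obtain f where f: "symmetry f" "f v = v" "f c = d" using ex_symmetry_rotation[OF cd] by blast
    obtain x where x: "arc x c" "x \<noteq> v" using ex_other_arc cd(1) by blast
    obtain t where "turn x c t" using x(1) ex_turn by blast
    then have "Corner v c x t \<in> corners" using x cd by (auto simp: corners_def)
    from agree[OF f(1) this] f show "\<exists>g\<in>\<Gamma>. base_map g v = v \<and> base_map g c = d"
      by auto
  qed
qed

section \<open>Local finiteness\<close>

primrec tree_projection :: "(nat, nat, nat) cvertex \<Rightarrow> nat" where
  "tree_projection (Base v) = v"
| "tree_projection (Fin i u) = u"

definition nbhd :: "nat set \<Rightarrow> nat set" where
  "nbhd A = A \<union> (\<Union>x\<in>A. {y. {x, y} \<in> edges X})"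

lemma finite_nbhd: "finite A \<Longrightarrow> finite (nbhd A)"
  by (simp add: nbhd_def finite_neighbours)

lemma nbhd_arc: "arc x y \<Longrightarrow> x \<in> A \<Longrightarrow> y \<in> nbhd A" "arc x y \<Longrightarrow> y \<in> A \<Longrightarrow> x \<in> nbhd A"
  by (auto simp: nbhd_def adjacent_iff_arc)

lemma subset_nbhd: "x \<in> A \<Longrightarrow> x \<in> nbhd A"
  by (simp add: nbhd_def)

lemma finite_corners_at: "finite {q \<in> corners. u \<in> verts (fin_graph q)}"
proof -
  define B where "B = nbhd (nbhd (nbhd (nbhd {u})))"
  have "finite B" by (simp add: B_def finite_nbhd)
  have "q \<in> (\<lambda>(w, y, x, t). Corner w y x t) ` (B \<times> B \<times> B \<times> B)"
    if q: "q \<in> corners" "u \<in> verts (fin_graph q)" for q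
  proof -
    obtain w y x t where c: "q = Corner w y x t" "arc w y" "arc x y" "arc x t"
      using q(1) turn_arc by (fastforce simp: corners_def)
    have "y \<in> nbhd (nbhd {u})"
    proof -
      have u: "u \<in> {u}" by simp
      consider "u = w" | "u = x" | "u = t" | "arc w u" using q(2) c(1) by auto
      then show ?thesis
      proof cases
        case 1
        then show ?thesis using nbhd_arc(1)[OF c(2)] subset_nbhd u by blast
      next
        case 2
        then show ?thesis using nbhd_arc(1)[OF c(3)] subset_nbhd u by blast
      next
        case 3
        then show ?thesis using nbhd_arc(1)[OF c(3)] nbhd_arc(2)[OF c(4)] u by blast
      next
        case 4
        then show ?thesis using nbhd_arc(1)[OF c(2)] nbhd_arc(2)[OF 4] u by blast
      qed
    qed
    then have "w \<in> B \<and> y \<in> B \<and> x \<in> B \<and> t \<in> B"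
      using nbhd_arc(2)[OF c(2)] nbhd_arc(2)[OF c(3)] nbhd_arc(1)[OF c(4)]
      by (simp add: B_def subset_nbhd)
    then show ?thesis using c(1) by force
  qed
  then have "{q \<in> corners. u \<in> verts (fin_graph q)} \<subseteq> (\<lambda>(w, y, x, t). Corner w y x t) ` (B \<times> B \<times> B \<times> B)"
    by blast
  then show ?thesis using \<open>finite B\<close> by (meson finite_SigmaI finite_imageI finite_subset)
qed

lemma finite_vertices_over:
  assumes "finite A"
  shows "finite {v \<in> vertices T. tree_projection v \<in> A}"
proof -
  have "{v \<in> vertices T. tree_projection v \<in> A} \<subseteq>
    Base ` A \<union> (\<Union>u\<in>A. (\<lambda>q. fin_vertex q u) ` {q \<in> corners. u \<in> verts (fin_graph q)})"
  proof
    fix v assume v: "v \<in> {v \<in> vertices T. tree_projection v \<in> A}"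
    then have "v \<in> vertices T" "tree_projection v \<in> A" by auto
    then show "v \<in> Base ` A \<union> (\<Union>u\<in>A. (\<lambda>q. fin_vertex q u) ` {q \<in> corners. u \<in> verts (fin_graph q)})"
      by (cases rule: vertices_cases) auto
  qed
  then show ?thesis
    using assms finite_corners_at by (elim finite_subset) auto
qed

lemma cell_over_nbhd:
  assumes "e \<in> cedges T \<union> squares T" "v \<in> e" "u \<in> e"
  shows "tree_projection u \<in> nbhd {tree_projection v}"
proof -
  have edge: "y \<in> nbhd {x}" if "d \<in> edges X" "x \<in> d" "y \<in> d" for d x y
  proof (cases "x = y")
    case False
    have "card d = 2" using that(1) tree_X by (simp add: tree_def)
    with False that(2,3) have "d = {x, y}" by (auto simp: card_2_iff)
    with that(1) show ?thesis by (simp add: nbhd_def)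
  qed (simp add: nbhd_def)
  from assms(1) show ?thesis
  proof
    assume "e \<in> cedges T"
    then show ?thesis
    proof (cases rule: cedges_cases)
      case (base d)
      with assms edge[of d] show ?thesis by auto
    next
      case (fin q d)
      with assms edge[of d] fin_graph_subgraph(2)[of q] show ?thesis by auto
    next
      case vertical
      with assms show ?thesis by (auto simp: nbhd_def)
    qed
  next
    assume "e \<in> squares T"
    then obtain q d where "e = Base ` d \<union> fin_vertex q ` d" "q \<in> corners" "d \<in> edges (fin_graph q)"
      unfolding squares_T by blast
    with assms edge[of d] fin_graph_subgraph(2)[of q] show ?thesis by auto
  qed
qed

lemma locally_finite_T: "locally_finite T"
  unfolding locally_finite_def
proof
  fix v assume "v \<in> vertices T"
  let ?B = "{u \<in> vertices T. tree_projection u \<in> nbhd {tree_projection v}}"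
  have fin: "finite (Pow ?B)" using finite_vertices_over finite_nbhd by simp
  have sub: "{e \<in> cedges T. v \<in> e} \<subseteq> Pow ?B" "{e \<in> squares T. v \<in> e} \<subseteq> Pow ?B"
    using cell_over_nbhd cells_in_vertices by blast+
  show "finite {e \<in> cedges T. v \<in> e} \<and> finite {s \<in> squares T. v \<in> s}"
    by (rule conjI[OF finite_subset[OF sub(1) fin] finite_subset[OF sub(2) fin]])
qed

section \<open>The points of the complex\<close>

definition edge_point :: "'a \<Rightarrow> 'a \<Rightarrow> real \<Rightarrow> 'a \<Rightarrow> real" where
  "edge_point a b s = (\<lambda>z. (1 - s) * of_bool (z = a) + s * of_bool (z = b))"

definition square_point ::
  "nat corner \<Rightarrow> nat \<Rightarrow> nat \<Rightarrow> real \<Rightarrow> real \<Rightarrow> (nat, nat, nat) cvertex \<Rightarrow> real" where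
  "square_point q a b s t =
     (\<lambda>z. (1 - t) * edge_point (Base a) (Base b) s z + t * edge_point (fin_vertex q a) (fin_vertex q b) s z)"

lemma push_eq_sum:
  assumes "finite S" "\<And>v. v \<notin> S \<Longrightarrow> w v = 0"
  shows "push g w z = (\<Sum>v\<in>S. w v * of_bool (g v = z))"
proof -
  have "push g w z = (\<Sum>v | w v \<noteq> 0 \<and> g v = z. w v * of_bool (g v = z))"
    unfolding push_def by (intro sum.cong) auto
  also have "\<dots> = (\<Sum>v\<in>S. w v * of_bool (g v = z))"
    using assms by (intro sum.mono_neutral_left) auto
  finally show ?thesis .
qed

lemma push_linear:
  assumes S: "finite S" "\<And>v. v \<notin> S \<Longrightarrow> f v = 0" "\<And>v. v \<notin> S \<Longrightarrow> h v = 0"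
  shows "push g (\<lambda>v. c * f v + d * h v) = (\<lambda>z. c * push g f z + d * push g h z)"
proof
  fix z
  have "push g (\<lambda>v. c * f v + d * h v) z = (\<Sum>v\<in>S. (c * f v + d * h v) * of_bool (g v = z))"
    using S by (intro push_eq_sum) auto
  also have "\<dots> = c * (\<Sum>v\<in>S. f v * of_bool (g v = z)) + d * (\<Sum>v\<in>S. h v * of_bool (g v = z))"
    by (simp add: sum_distrib_left sum.distrib[symmetric] algebra_simps)
  also have "\<dots> = c * push g f z + d * push g h z"
    using S by (simp add: push_eq_sum[where S = S])
  finally show "push g (\<lambda>v. c * f v + d * h v) z = c * push g f z + d * push g h z" .
qed

lemma edge_point_eq_vertex_points:
  "edge_point a b s = (\<lambda>z. (1 - s) * vertex_point a z + s * vertex_point b z)"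
  by (auto simp: edge_point_def vertex_point_def)

lemma push_edge_point: "push g (edge_point a b s) = edge_point (g a) (g b) s"
  unfolding edge_point_eq_vertex_points
  by (subst push_linear[of "{a, b}"]) (auto simp: push_vertex_point, auto simp: vertex_point_def)

lemma cylinder_point_edge_point:
  "cylinder_point T (to_nat q) (edge_point a b s) t = square_point q a b s t"
  by (simp add: cylinder_point_def push_edge_point square_point_def)

lemma push_square_point:
  "push g (square_point q a b s t) =
    (\<lambda>z. (1 - t) * edge_point (g (Base a)) (g (Base b)) s z +
      t * edge_point (g (fin_vertex q a)) (g (fin_vertex q b)) s z)"
  unfolding square_point_def
  by (subst push_linear[of "{Base a, Base b, fin_vertex q a, fin_vertex q b}"])
    (auto simp: push_edge_point, auto simp: edge_point_def)

lemma edge_point_in_graph: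
  assumes G: "tree G" and e: "{a, b} \<in> edges G" and s: "0 \<le> s" "s \<le> 1"
  shows "edge_point a b s \<in> graph_points G"
proof -
  have ab: "a \<noteq> b" "a \<in> verts G" "b \<in> verts G"
    using G e by (auto simp: tree_def)
  have "edge_point a b 0 = vertex_point a" "edge_point a b 1 = vertex_point b"
    by (simp_all add: edge_point_eq_vertex_points)
  moreover have ?thesis if "s \<noteq> 0" "s \<noteq> 1"
  proof -
    have supp: "{v. edge_point a b s v \<noteq> 0} = {a, b}"
      using that ab by (auto simp: edge_point_def of_bool_def)
    have "sum (edge_point a b s) {a, b} = 1"
      using ab by (simp add: edge_point_def)
    moreover have "\<forall>v. 0 \<le> edge_point a b s v"
      using s by (simp add: edge_point_def)
    ultimately show ?thesis
      unfolding graph_points_def mem_Collect_eq supp using e by (intro conjI UnI2)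
  qed
  ultimately show ?thesis using vertex_point_in_graph ab by metis
qed

lemma graph_point_on_edge:
  assumes G: "tree G" and cover: "\<And>v. v \<in> verts G \<Longrightarrow> \<exists>e\<in>edges G. v \<in> e"
    and w: "w \<in> graph_points G"
  obtains a b s where "{a, b} \<in> edges G" "0 \<le> s" "s \<le> 1" "w = edge_point a b s"
proof -
  let ?S = "{v. w v \<noteq> 0}"
  have w': "\<And>v. 0 \<le> w v" "sum w ?S = 1" and S: "?S \<in> {{v} | v. v \<in> verts G} \<union> edges G"
    using w by (auto simp: graph_points_def)
  from S consider v where "v \<in> verts G" "?S = {v}" | "?S \<in> edges G" by blast
  then show ?thesis
  proof cases
    case 1
    from cover[OF 1(1)] obtain e where e: "e \<in> edges G" "v \<in> e" by blast
    then have "card e = 2" using G by (simp add: tree_def)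
    then obtain b where "e = {v, b}" using e(2) by (auto simp: card_2_iff)
    moreover have "w = edge_point v b 0"
      using w'(2) 1(2) by (auto simp: edge_point_def fun_eq_iff)
    ultimately show ?thesis using that[of v b 0] e by simp
  next
    case 2
    then have "card ?S = 2" using G by (simp add: tree_def)
    then obtain a b where ab: "?S = {a, b}" "a \<noteq> b" by (auto simp: card_2_iff)
    have sum: "w a + w b = 1" using w'(2) ab by simp
    have "w = edge_point a b (w b)"
    proof
      fix z show "w z = edge_point a b (w b) z"
        using ab sum by (auto simp: edge_point_def of_bool_def)
    qed
    moreover have "0 \<le> w b" "w b \<le> 1" using w'(1)[of a] w'(1)[of b] sum by auto
    ultimately show ?thesis using that[of a b "w b"] 2 ab(1) by simp
  qed
qed

lemma arc_in_fin: "arc a b \<Longrightarrow> \<exists>q\<in>corners. {a, b} \<in> edges (fin_graph q)"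
proof -
  assume ab: "arc a b"
  then obtain x where x: "arc x b" "x \<noteq> a" using ex_other_arc by blast
  then obtain t where "turn x b t" using ex_turn by blast
  then have "Corner a b x t \<in> corners" using ab x by (auto simp: corners_def)
  moreover have "{a, b} \<in> edges (fin_graph (Corner a b x t))" using ab by auto
  ultimately show ?thesis by blast
qed

lemma square_point_in_realization:
  assumes "q \<in> corners" "{a, b} \<in> edges (fin_graph q)" "0 \<le> s" "s \<le> 1" "0 \<le> t" "t \<le> 1"
  shows "square_point q a b s t \<in> realization T"
proof -
  have "edge_point a b s \<in> graph_points (fin_tree T (to_nat q))"
    using edge_point_in_graph[OF tree_fin_graph] assms by simp
  moreover have "to_nat q \<in> fin_index T" using assms(1) by simp
  ultimately show ?thesis
    unfolding realization_def cylinder_point_edge_point[symmetric] using assms(5,6)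
    by (intro UnI2 CollectI exI[of _ "to_nat q"] exI[of _ "edge_point a b s"] exI[of _ t]) simp
qed

text \<open>Every edge of the tree belongs to a fin, so the squares cover the complex.\<close>

lemma realization_cases:
  assumes "p \<in> realization T"
  obtains q a b s t where "q \<in> corners" "{a, b} \<in> edges (fin_graph q)" "0 \<le> s" "s \<le> 1" "0 \<le> t" "t \<le> 1"
    "p = square_point q a b s t"
proof -
  consider w where "p = push Base w" "w \<in> graph_points X"
    | q w t where "q \<in> corners" "w \<in> graph_points (fin_graph q)" "0 \<le> t" "t \<le> 1"
      "p = cylinder_point T (to_nat q) w t"
    using assms unfolding realization_def by auto
  then show ?thesis
  proof cases
    case 1
    have cover: "\<exists>e\<in>edges X. v \<in> e" if "v \<in> verts X" for v
      using that by (auto simp: edges_X)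
    obtain a b s where s: "{a, b} \<in> edges X" "0 \<le> s" "s \<le> 1" "w = edge_point a b s"
      using graph_point_on_edge[OF tree_X cover 1(2)] by blast
    have "\<exists>q\<in>corners. {a, b} \<in> edges (fin_graph q)"
      using s(1) arc_in_fin[of a b] arc_in_fin[of b a] unfolding adjacent_iff_arc
      by (auto simp: insert_commute)
    then obtain q where q: "q \<in> corners" "{a, b} \<in> edges (fin_graph q)" by blast
    have "p = square_point q a b s 0"
      using 1(1) s(4) by (simp add: push_edge_point square_point_def)
    with that[OF q s(2,3), of 0] show ?thesis by simp
  next
    case 2
    have cover: "\<exists>e\<in>edges (fin_graph q). v \<in> e" if v: "v \<in> verts (fin_graph q)" for v
    proof -
      obtain w y x t where q: "q = Corner w y x t" "arc w y"
        using 2(1) by (auto simp: corners_def)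
      then consider "v = w" | "v = x" | "v = t" | "arc w v" using v by auto
      then show ?thesis using q by cases auto
    qed
    obtain a b s where "{a, b} \<in> edges (fin_graph q)" "0 \<le> s" "s \<le> 1" "w = edge_point a b s"
      using graph_point_on_edge[OF tree_fin_graph[OF 2(1)] cover 2(2)] by blast
    with that[of q a b s t] 2 cylinder_point_edge_point show ?thesis by simp
  qed
qed

lemma push_lift_square_point:
  assumes "q \<in> corners" "{a, b} \<in> edges (fin_graph q)"
  shows "push (lift f) (square_point q a b s t) = square_point (map_corner f q) (f a) (f b) s t"
proof -
  have ab: "a \<in> verts (fin_graph q)" "b \<in> verts (fin_graph q)"
    using fin_graph_subgraph(3)[OF assms] by auto
  then have "a \<in> V" "b \<in> V" using fin_graph_subgraph(1)[OF assms(1)] by auto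
  with ab assms(1) show ?thesis by (simp add: push_square_point) (simp add: square_point_def)
qed

lemma push_lift_realization:
  assumes f: "symmetry f" and p: "p \<in> realization T"
  shows "push (lift f) p \<in> realization T"
  using p
proof (rule realization_cases)
  fix q a b s t
  assume q: "q \<in> corners" "{a, b} \<in> edges (fin_graph q)" and st: "0 \<le> s" "s \<le> 1" "0 \<le> t" "t \<le> 1"
    and p: "p = square_point q a b s t"
  have "{f a, f b} \<in> edges (fin_graph (map_corner f q))"
    using symmetry_corner(3)[OF f q] by simp
  then show ?thesis
    unfolding p push_lift_square_point[OF q]
    using symmetry_corner(1)[OF f q(1)] st by (intro square_point_in_realization)
qed

lemma realization_support:
  assumes "p \<in> realization T" "p u \<noteq> 0" "p v \<noteq> 0"
  shows "u \<in> vertices T \<and> tree_projection v \<in> nbhd {tree_projection u}"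
  using assms(1)
proof (rule realization_cases)
  fix q a b s t
  assume q: "q \<in> corners" "{a, b} \<in> edges (fin_graph q)" and p: "p = square_point q a b s t"
  let ?e = "Base ` {a, b} \<union> fin_vertex q ` {a, b}"
  have e: "?e \<in> squares T" using squaresI[OF q] .
  have "z \<in> ?e" if "p z \<noteq> 0" for z
    using that by (auto simp: p square_point_def edge_point_def of_bool_def split: if_splits)
  then have uv: "u \<in> ?e" "v \<in> ?e" using assms by blast+
  then show "u \<in> vertices T \<and> tree_projection v \<in> nbhd {tree_projection u}"
    using cells_in_vertices(2)[OF e] cell_over_nbhd[OF UnI2[OF e] uv] by blast
qed

lemma realization_positive:
  assumes "p \<in> realization T"
  shows "\<exists>v. 0 < p v"
  using assms
proof (rule realization_cases)
  fix q a b s t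
  assume q: "q \<in> corners" "{a, b} \<in> edges (fin_graph q)" and st: "0 \<le> s" "s \<le> 1" "0 \<le> t" "t \<le> 1"
    and p: "p = square_point q a b s t"
  have "a \<noteq> b" using tree_fin_graph[OF q(1)] q(2) by (auto simp: tree_def)
  then have c: "p (Base a) = (1 - t) * (1 - s)" "p (Base b) = (1 - t) * s"
      "p (fin_vertex q a) = t * (1 - s)" "p (fin_vertex q b) = t * s"
    by (simp_all add: p square_point_def edge_point_def)
  have "t < 1 \<or> 0 < t" "s < 1 \<or> 0 < s" using st by auto
  then show ?thesis
    using c by (metis diff_gt_0_iff_gt mult_pos_pos)
qed

section \<open>The translations form a uniform lattice\<close>

definition translation_group :: "((nat, nat, nat) cvertex \<Rightarrow> (nat, nat, nat) cvertex) set" where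
  "translation_group = lift ` {f. translation f}"

lemma translations_subgroup: "subgroup translation_group (Aut T)"
proof (rule group.subgroupI[OF group_Aut])
  show "translation_group \<subseteq> carrier (Aut T)"
    using lift_automorphism translation_symmetry by (auto simp: translation_group_def carrier_Aut)
  show "translation_group \<noteq> {}"
    using translation_id by (auto simp: translation_group_def)
next
  have mult: "lift f \<otimes>\<^bsub>Aut T\<^esub> lift g = lift (f \<circ> g)" if "translation f" "translation g" for f g
  proof -
    have s: "symmetry f" "symmetry g" using that translation_symmetry by blast+
    have "compose (vertices T) (lift f) (lift g) = lift (f \<circ> g)"
    proof
      fix v show "compose (vertices T) (lift f) (lift g) v = lift (f \<circ> g) v"
      proof (cases "v \<in> vertices T")
        case True
        then show ?thesis using lift_compose[OF s] by (simp add: compose_eq)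
      next
        case False
        then show ?thesis by (simp add: compose_def lift_def)
      qed
    qed
    then show ?thesis using s lift_automorphism by (simp add: mult_Aut)
  qed
  fix g assume "g \<in> translation_group"
  then obtain f where f: "translation f" "g = lift f" by (auto simp: translation_group_def)
  have "lift (inv_into V f) \<otimes>\<^bsub>Aut T\<^esub> g = lift (inv_into V f \<circ> f)"
    using mult[OF translation_inverse[OF f(1)] f(1)] f(2) by simp
  also have "\<dots> = lift id"
    using inv_symmetry(2)[OF translation_symmetry[OF f(1)]] by (intro lift_cong) simp
  also have "\<dots> = \<one>\<^bsub>Aut T\<^esub>"
    using lift_id by (auto simp: one_Aut fun_eq_iff lift_def)
  finally have "inv\<^bsub>Aut T\<^esub> g = lift (inv_into V f)"
    using lift_automorphism translation_symmetry translation_inverse f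
    by (intro group.inv_equality[OF group_Aut]) (auto simp: carrier_Aut)
  then show "inv\<^bsub>Aut T\<^esub> g \<in> translation_group"
    using translation_inverse[OF f(1)] by (simp add: translation_group_def)
  fix h assume "h \<in> translation_group"
  then obtain f' where "translation f'" "h = lift f'" by (auto simp: translation_group_def)
  then show "g \<otimes>\<^bsub>Aut T\<^esub> h \<in> translation_group"
    using f mult translation_compose by (auto simp: translation_group_def)
qed

lemma open_star: "open {p :: 'a \<Rightarrow> real. 0 < p v}"
  by (intro open_Collect_less continuous_on_const continuous_on_product_coordinates)

lemma finite_translations_between:
  assumes "a \<in> V"
  shows "finite {g \<in> translation_group. base_map g a = b}"
proof -
  have "g = h" if gh: "g \<in> translation_group" "base_map g a = b" "h \<in> translation_group" "base_map h a = b" for g h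
  proof -
    obtain f f' where f: "translation f" "g = lift f" "translation f'" "h = lift f'"
      using gh(1,3) by (auto simp: translation_group_def)
    then have "f a = f' a"
      using gh(2,4) assms base_map_lift translation_symmetry by metis
    then have "f x = f' x" if "x \<in> V" for x
      using translation_determined f assms that by blast
    then show ?thesis unfolding f(2,4) by (rule lift_cong)
  qed
  then have "\<exists>g. {g \<in> translation_group. base_map g a = b} \<subseteq> {g}" by blast
  then show ?thesis using finite_subset by blast
qed

text \<open>A compact set is covered by the open stars of finitely many vertices.  If a translation moves one
  of its points to another, then it moves a vertex near these finitely many to one of them.\<close>

lemma translations_proper: "acts_properly T translation_group"
  unfolding acts_properly_def
proof (intro allI impI)
  fix K assume "K \<subseteq> realization T \<and> compact K"
  then have K: "K \<subseteq> realization T" "compact K" by auto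
  have cover: "K \<subseteq> (\<Union>v\<in>UNIV. {p. 0 < p v})"
    using K(1) realization_positive by blast
  obtain C :: "(nat, nat, nat) cvertex set" where C: "finite C" "K \<subseteq> (\<Union>v\<in>C. {p. 0 < p v})"
    by (rule compactE_image[OF K(2) open_star cover])
  let ?A = "tree_projection ` C"
  have "finite (\<Union>a\<in>nbhd ?A \<inter> V. \<Union>b\<in>?A. {g \<in> translation_group. base_map g a = b})"
    using C(1) finite_nbhd finite_translations_between by auto
  moreover have "{g \<in> translation_group. push g ` K \<inter> K \<noteq> {}}
    \<subseteq> (\<Union>a\<in>nbhd ?A \<inter> V. \<Union>b\<in>?A. {g \<in> translation_group. base_map g a = b})"
  proof
    fix g assume "g \<in> {g \<in> translation_group. push g ` K \<inter> K \<noteq> {}}"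
    then obtain p where g: "g \<in> translation_group" and p: "p \<in> K" "push g p \<in> K" by blast
    obtain f where f: "translation f" "g = lift f" using g by (auto simp: translation_group_def)
    obtain u where u: "u \<in> C" "0 < push g p u" using C(2) p(2) by blast
    obtain v0 where v0: "v0 \<in> C" "0 < p v0" using C(2) p(1) by blast
    have "\<exists>v. p v \<noteq> 0 \<and> g v = u"
    proof (rule ccontr)
      assume "\<not> ?thesis"
      then have "{v. p v \<noteq> 0 \<and> g v = u} = {}" by blast
      then show False using u(2) unfolding push_def by (metis less_irrefl sum.empty)
    qed
    then obtain v where v: "p v \<noteq> 0" "g v = u" by blast
    have "p \<in> realization T" using p(1) K(1) by blast
    then have near: "v \<in> vertices T" "tree_projection v \<in> nbhd {tree_projection v0}"
      using realization_support[of p v0 v] realization_support[of p v v] v v0 by auto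
    have "tree_projection v \<in> nbhd ?A" using near(2) v0(1) by (auto simp: nbhd_def)
    moreover have "tree_projection v \<in> V \<and> base_map g (tree_projection v) = tree_projection u"
      using near(1)
    proof (cases rule: vertices_cases)
      case (1 z)
      then show ?thesis using v(2) f base_map_lift[OF translation_symmetry] by auto
    next
      case (2 q z)
      then have "z \<in> V" using fin_graph_subgraph(1) by blast
      with 2 show ?thesis using v(2) f base_map_lift[OF translation_symmetry] by auto
    qed
    ultimately show "g \<in> (\<Union>a\<in>nbhd ?A \<inter> V. \<Union>b\<in>?A. {g \<in> translation_group. base_map g a = b})"
      using g u(1) by blast
  qed
  ultimately show "finite {g \<in> translation_group. push g ` K \<inter> K \<noteq> {}}"
    by (rule rev_finite_subset)
qed

lemma compact_square:
  "compact ((\<lambda>(s, t). square_point q a b s t) ` ({0..1} \<times> {0..1}))"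
proof (rule compact_continuous_image)
  show "continuous_on ({0..1} \<times> {0..1}) (\<lambda>(s, t). square_point q a b s t)"
    unfolding square_point_def edge_point_def case_prod_beta
    by (intro continuous_on_coordinatewise_then_product continuous_intros)
  show "compact ({0..1 :: real} \<times> {0..1 :: real})"
    by (intro compact_Times compact_Icc)
qed

lemma finite_fin_graph: "finite (verts (fin_graph q))"
proof (cases q)
  case (Corner w y x t)
  have "{z. arc w z} \<subseteq> {z. {w, z} \<in> edges X}" using adjacent_iff_arc by blast
  then show ?thesis using finite_neighbours finite_subset by (auto simp: Corner)
qed

text \<open>Finitely many fins contain the origin, and every fin can be translated to one of them.\<close>

lemma translations_cocompact: "acts_cocompactly T translation_group"
proof -
  define I where "I = {(q, a, b). q \<in> corners \<and> origin \<in> verts (fin_graph q) \<and> {a, b} \<in> edges (fin_graph q)}"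
  define K where "K = (\<Union>(q, a, b)\<in>I. (\<lambda>(s, t). square_point q a b s t) ` ({0..1} \<times> {0..1}))"
  have "I \<subseteq> (\<Union>q\<in>{q \<in> corners. origin \<in> verts (fin_graph q)}. {q} \<times> verts (fin_graph q) \<times> verts (fin_graph q))"
    using fin_graph_subgraph(3) by (fastforce simp: I_def)
  then have "finite I"
    using finite_corners_at finite_fin_graph by (elim finite_subset) auto
  then have "compact K"
    unfolding K_def using compact_square by (intro compact_UN) auto
  moreover have K: "K \<subseteq> realization T"
    unfolding K_def I_def using square_point_in_realization by auto
  moreover have "(\<Union>g\<in>translation_group. push g ` K) = realization T"
  proof
    show "(\<Union>g\<in>translation_group. push g ` K) \<subseteq> realization T"
      using K push_lift_realization translation_symmetry by (auto simp: translation_group_def)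
    show "realization T \<subseteq> (\<Union>g\<in>translation_group. push g ` K)"
    proof
      fix p assume "p \<in> realization T"
      then show "p \<in> (\<Union>g\<in>translation_group. push g ` K)"
      proof (rule realization_cases)
        fix q a b s t
        assume q: "q \<in> corners" "{a, b} \<in> edges (fin_graph q)"
          and st: "0 \<le> s" "s \<le> 1" "0 \<le> t" "t \<le> 1" and p: "p = square_point q a b s t"
        have ab: "a \<in> verts (fin_graph q)" "a \<in> V" "b \<in> V"
          using fin_graph_subgraph(3)[OF q] fin_graph_subgraph(1)[OF q(1)] by auto
        obtain f where f: "translation f" "f a = origin"
          using translation_transitive[OF ab(2) origin_in_V] by blast
        note fs = translation_symmetry[OF f(1)] and gs = translation_symmetry[OF translation_inverse[OF f(1)]]
        let ?g = "inv_into V f" and ?r = "map_corner f q"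
        have r: "?r \<in> corners" "{f a, f b} \<in> edges (fin_graph ?r)" "origin \<in> verts (fin_graph ?r)"
          using symmetry_corner(1)[OF fs q(1)] symmetry_corner(3)[OF fs q] symmetry_corner(2)[OF fs q(1) ab(1)] f(2)
          by auto
        have undo: "?g (f z) = z" if "z \<in> V" for z using inv_symmetry(2)[OF fs that] .
        have "map_corner ?g ?r = q"
        proof -
          have "lift ?g (lift f (fin_vertex q a)) = fin_vertex q a"
            by (rule lift_lift_inverse(2)[OF fs]) (use q(1) ab(1) in simp)
          then show ?thesis
            using q(1) ab(1) r(1) symmetry_corner(2)[OF fs q(1) ab(1)] by simp
        qed
        then have "push (lift ?g) (square_point ?r (f a) (f b) s t) = p"
          using push_lift_square_point[OF r(1,2)] undo ab p by simp
        moreover have "square_point ?r (f a) (f b) s t \<in> K"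
          unfolding K_def I_def using r st by force
        moreover have "lift ?g \<in> translation_group"
          using translation_inverse[OF f(1)] by (simp add: translation_group_def)
        ultimately show ?thesis by blast
      qed
    qed
  qed
  ultimately show ?thesis unfolding acts_cocompactly_def by blast
qed

lemma uniform_T: "uniform T"
  unfolding uniform_def uniform_lattice_def
  using translations_subgroup translations_proper translations_cocompact by blast

theorem theorem1p4:
  shows "\<exists>T :: (nat, nat, nat) fin_data.
    tree_with_fins T \<and> locally_finite T \<and> uniform T \<and>
    \<not> (\<exists>\<Gamma>. uniform_lattice T \<Gamma> \<and> natural_map_iso T \<Gamma>) \<and>
    \<not> (\<exists>\<Gamma>. uniform_lattice T \<Gamma> \<and>
        (\<forall>x\<in>verts (base_tree T).
           induced_permutations T (automorphisms T) x \<subseteq> induced_permutations T \<Gamma> x))"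
proof (intro exI[of _ T] conjI notI)
  show "tree_with_fins T" by (rule tree_with_fins_T)
  show "locally_finite T" by (rule locally_finite_T)
  show "uniform T" by (rule uniform_T)
next
  assume "\<exists>\<Gamma>. uniform_lattice T \<Gamma> \<and> natural_map_iso T \<Gamma>"
  then show False
    using natural_map_iso_locally_full locally_full_not_proper unfolding uniform_lattice_def by blast
next
  assume "\<exists>\<Gamma>. uniform_lattice T \<Gamma> \<and>
    (\<forall>x\<in>verts (base_tree T).
       induced_permutations T (automorphisms T) x \<subseteq> induced_permutations T \<Gamma> x)"
  then obtain \<Gamma> where \<Gamma>: "subgroup \<Gamma> (Aut T)" "acts_properly T \<Gamma>"
    and "\<And>x. x \<in> V \<Longrightarrow> induced_permutations T (automorphisms T) x \<subseteq> induced_permutations T \<Gamma> x"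
    unfolding uniform_lattice_def by auto
  then have "locally_full \<Gamma>" by (intro same_permutations_locally_full)
  with \<Gamma> show False using locally_full_not_proper by blast
qed

end
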